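(* Let $\mathcal F$ be an Ore forest-skein category, let $G\subset G^T\subset G^V$ be its $F$-, $T$- and $V$-forest-skein groups, and let $\alpha:G^V\curvearrowright X$ be the action and $\preceq$ the total order on $X$ defined in the context. Then $$G=\{g\in G^V:\ \alpha_g(x)\preceq\alpha_g(y)\text{ for all }x,y\in X\text{ with }x\preceq y\}.$$ Moreover $G^T$ is the set of $g\in G^V$ such that for every $k\ge 1$ and every chain $x_1\preceq x_2\preceq\cdots\preceq x_k$ in $X$ there exists a cyclic permutation $\pi\in\mathbf Z/k\mathbf Z$ satisfying $$\alpha_g(x_{\pi(1)})\preceq\alpha_g(x_{\pi(2)})\preceq\cdots\preceq\alpha_g(x_{\pi(k)}).$$
   Context: Trees are finite ordered rooted binary trees; a forest is a finite list of trees, with roots and leaves ordered from left to right. A coloured forest over a nonempty set $S$ has each interior (non-leaf) vertex labelled by an element of $S$. If $f$ has as many leaves as $g$ has roots, $f\circ g=fg$ is the stacking of $g$ on top of $f$; $f\otimes g$ is horizontal concatenation. Given a set $R$ of pairs of coloured trees with the same number of leaves, $\mathrm{ForC}\langle S\mid R\rangle$ is the quotient of the set of coloured forests over $S$ by the smallest equivalence relation containing $R$ and closed under composition and tensor product with forests, a small monoidal category. A forest-skein category is a category of this form. It is an Ore category if it is left-cancellative and for all $f,g$ with the same number of roots there are $p,q$ with $fp=gq$. The category $\mathcal F^V$ has elements $f\circ\sigma$, $f\in\mathcal F$ with $n$ leaves and $\sigma\in\Sigma_n$, composed using $\sigma\circ f=f^\sigma\circ\sigma^f$, where for $f=(f_1,\dots,f_r)$,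 $f^\sigma$ is the forest whose tree at position $\sigma(j)$ is $f_j$, and $\sigma^f$ sends the leaves of $f_j$ in order to the leaves of the $\sigma(j)$th tree of $f^\sigma$. $G^V=\mathrm{Frac}(\mathcal F^V,1)$ is the group of fractions $s\circ\pi\circ t^{-1}$ with $s,t$ trees with the same number $n$ of leaves and $\pi\in\Sigma_n$, where fractions $xy^{-1}$ and $(xh)(yh)^{-1}$ are identified and $(xy^{-1})(x'y'^{-1})=(xp)(y'p')^{-1}$ whenever $yp=x'p'$. $G^T$ (resp. $G$) is the subgroup of those elements admitting a representative with $\pi$ in the cyclic group $\mathbf Z/n\mathbf Z$ generated by $j\mapsto j+1$ mod $n$ (resp. $\pi=\mathrm{id}$). The set $X$: for a forest $f=(f_1,\dots,f_r)$ and $1\le j\le r$ let $j^f=1+$ (the number of leaves of $(f_1,\dots,f_{j-1})$). $X$ is the set of classes $[t,j]$ of pairs $(t,j)$ with $t$ a tree of $\mathcal F$ with $n$ leaves and $1\le j\le n$, for the equivalence relation generated by $(t,j)\sim(tf,j^f)$. The action $\alpha$ is determined by $\alpha_{s\circ\pi\circ t^{-1}}([t,j])=[s,\pi(j)]$. The total order is: $[t,j]\preceq[t',j']$ if $j^f\le j'^{f'}$ for some (equivalently any) forests $f,f'$ with $tf=t'f'$. *)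

theory Defs
  imports "HOL-Algebra.Group" "HOL-Library.Tree" "HOL-Combinatorics.Permutations"
begin

section \<open>Coloured forests\<close>

text \<open>
  The colours are the elements of the (nonempty) type \<open>'s\<close>.  A library tree over \<open>'s\<close> is a finite
  ordered rooted binary tree whose interior vertices are labelled by colours, and \<open>size1\<close> is its
  number of leaves.
\<close>

type_synonym 's forest = "'s tree list"

definition leaf_count :: "'s forest \<Rightarrow> nat" where
  "leaf_count f = sum_list (map size1 f)"

text \<open>\<open>graft t g\<close> replaces the leaves of \<open>t\<close>, from left to right, by the trees of \<open>g\<close>; it is only
  meaningful if \<open>length g = size1 t\<close>.\<close>

fun graft :: "'s tree \<Rightarrow> 's forest \<Rightarrow> 's tree" where
  "graft Leaf g = hd g"
| "graft (Node l a r) g = Node (graft l (take (size1 l) g)) a (graft r (drop (size1 l) g))"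

text \<open>\<open>stack f g\<close> is the composition \<open>f \<circ> g\<close>; it is only meaningful if
  \<open>leaf_count f = length g\<close>.  The tensor product of forests is list concatenation.\<close>

fun stack :: "'s forest \<Rightarrow> 's forest \<Rightarrow> 's forest" where
  "stack [] g = []"
| "stack (t # f) g = graft t (take (size1 t) g) # stack f (drop (size1 t) g)"

text \<open>\<open>first_leaf f j\<close> is \<open>j\<^sup>f\<close>.  Positions of trees and leaves in a forest are numbered from 1, while
  list indices start at 0.\<close>

definition first_leaf :: "'s forest \<Rightarrow> nat \<Rightarrow> nat" where
  "first_leaf f j = 1 + leaf_count (take (j - 1) f)"

text \<open>\<open>permute_trees \<sigma> f\<close> is \<open>f\<^sup>\<sigma>\<close>: its tree at position \<open>i\<close> is the tree of \<open>f\<close> at position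
  \<open>\<sigma>\<^sup>-\<^sup>1 i\<close>, hence its tree at position \<open>\<sigma> j\<close> is the one of \<open>f\<close> at position \<open>j\<close>.\<close>

definition permute_trees :: "(nat \<Rightarrow> nat) \<Rightarrow> 's forest \<Rightarrow> 's forest" where
  "permute_trees \<sigma> f = map (\<lambda>i. f ! (inv_into UNIV \<sigma> i - 1)) [1..<length f + 1]"

text \<open>\<open>permute_leaves \<sigma> f\<close> is \<open>\<sigma>\<^sup>f\<close>, extended by the identity outside \<open>{1..leaf_count f}\<close>: the
  leaf number \<open>k + 1\<close> of the tree \<open>j\<close> of \<open>f\<close> is sent to the leaf number \<open>k + 1\<close> of the tree \<open>\<sigma> j\<close>
  of \<open>f\<^sup>\<sigma>\<close>.\<close>

definition permute_leaves :: "(nat \<Rightarrow> nat) \<Rightarrow> 's forest \<Rightarrow> nat \<Rightarrow> nat" where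
  "permute_leaves \<sigma> f i =
     (if i \<in> {1..leaf_count f}
      then THE i'. \<exists>j\<in>{1..length f}. \<exists>k < size1 (f ! (j - 1)).
             i = first_leaf f j + k \<and> i' = first_leaf (permute_trees \<sigma> f) (\<sigma> j) + k
      else i)"


section \<open>Categories with objects the natural numbers, Ore condition, groups of fractions\<close>

text \<open>Composition is written in the order of stacking: \<open>cmp C f g\<close> is \<open>f \<circ> g\<close>, defined when
  \<open>leaves C f = roots C g\<close>.\<close>

record 'm nat_category =
  mor :: "'m set"
  roots :: "'m \<Rightarrow> nat"
  leaves :: "'m \<Rightarrow> nat"
  cmp :: "'m \<Rightarrow> 'm \<Rightarrow> 'm"
  ide :: "nat \<Rightarrow> 'm"

definition left_cancellative :: "'m nat_category \<Rightarrow> bool" where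
  "left_cancellative C \<longleftrightarrow>
     (\<forall>f\<in>mor C. \<forall>p\<in>mor C. \<forall>q\<in>mor C.
        leaves C f = roots C p \<and> leaves C f = roots C q \<and> cmp C f p = cmp C f q \<longrightarrow> p = q)"

definition ore_category :: "'m nat_category \<Rightarrow> bool" where
  "ore_category C \<longleftrightarrow> left_cancellative C \<and>
     (\<forall>f\<in>mor C. \<forall>g\<in>mor C. roots C f = roots C g \<longrightarrow>
        (\<exists>p\<in>mor C. \<exists>q\<in>mor C.
           leaves C f = roots C p \<and> leaves C g = roots C q \<and> cmp C f p = cmp C g q))"

text \<open>A pair \<open>(x, y)\<close> in \<open>fractions C a\<close> stands for the formal fraction \<open>x y\<^sup>-\<^sup>1\<close>.\<close>

definition fractions :: "'m nat_category \<Rightarrow> nat \<Rightarrow> ('m \<times> 'm) set" where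
  "fractions C a = {(x, y). x \<in> mor C \<and> y \<in> mor C \<and>
                      roots C x = a \<and> roots C y = a \<and> leaves C x = leaves C y}"

definition fraction_step :: "'m nat_category \<Rightarrow> nat \<Rightarrow> 'm \<times> 'm \<Rightarrow> 'm \<times> 'm \<Rightarrow> bool" where
  "fraction_step C a p q \<longleftrightarrow> p \<in> fractions C a \<and>
     (\<exists>h\<in>mor C. leaves C (fst p) = roots C h \<and> q = (cmp C (fst p) h, cmp C (snd p) h))"

definition fraction_class :: "'m nat_category \<Rightarrow> nat \<Rightarrow> 'm \<times> 'm \<Rightarrow> ('m \<times> 'm) set" where
  "fraction_class C a p = {q. equivclp (fraction_step C a) p q}"

definition Frac :: "'m nat_category \<Rightarrow> nat \<Rightarrow> ('m \<times> 'm) set monoid" where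
  "Frac C a =
    \<lparr>carrier = fraction_class C a ` fractions C a,
     monoid.mult = (\<lambda>P Q. the_elem {fraction_class C a (cmp C x p, cmp C y' p') | x y x' y' p p'.
               (x, y) \<in> fractions C a \<and> (x', y') \<in> fractions C a \<and>
               P = fraction_class C a (x, y) \<and> Q = fraction_class C a (x', y') \<and>
               p \<in> mor C \<and> p' \<in> mor C \<and> leaves C y = roots C p \<and> leaves C x' = roots C p' \<and>
               cmp C y p = cmp C x' p'}),
     one = fraction_class C a (ide C a, ide C a)\<rparr>"


section \<open>Forest-skein categories\<close>

inductive skein_eq :: "('s tree \<times> 's tree) set \<Rightarrow> 's forest \<Rightarrow> 's forest \<Rightarrow> bool"
  for R :: "('s tree \<times> 's tree) set" where
  base: "(t, u) \<in> R \<Longrightarrow> skein_eq R [t] [u]"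
| refl: "skein_eq R f f"
| sym: "skein_eq R f g \<Longrightarrow> skein_eq R g f"
| trans: "skein_eq R f g \<Longrightarrow> skein_eq R g h \<Longrightarrow> skein_eq R f h"
| stack_left: "skein_eq R f g \<Longrightarrow> leaf_count h = length f \<Longrightarrow> leaf_count h = length g \<Longrightarrow>
    skein_eq R (stack h f) (stack h g)"
| stack_right: "skein_eq R f g \<Longrightarrow> leaf_count f = length h \<Longrightarrow> leaf_count g = length h \<Longrightarrow>
    skein_eq R (stack f h) (stack g h)"
| tensor_left: "skein_eq R f g \<Longrightarrow> skein_eq R (h @ f) (h @ g)"
| tensor_right: "skein_eq R f g \<Longrightarrow> skein_eq R (f @ h) (g @ h)"

definition skein_class :: "('s tree \<times> 's tree) set \<Rightarrow> 's forest \<Rightarrow> 's forest set" where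
  "skein_class R f = {g. skein_eq R f g}"

text \<open>\<open>on_class \<phi> A\<close> is the common value of \<open>\<phi>\<close> on the representatives of the class \<open>A\<close>.  If \<open>R\<close>
  relates only trees with the same number of leaves, then equivalent forests have the same number of
  trees, and their trees in equal positions have the same number of leaves, so that every function
  lifted below is constant on classes.\<close>

definition on_class :: "('f \<Rightarrow> 'b) \<Rightarrow> 'f set \<Rightarrow> 'b" where
  "on_class \<phi> A = the_elem (\<phi> ` A)"

definition ForC :: "('s tree \<times> 's tree) set \<Rightarrow> 's forest set nat_category" where
  "ForC R =
    \<lparr>mor = range (skein_class R),
     roots = on_class length,
     leaves = on_class leaf_count,
     cmp = (\<lambda>A B. on_class (\<lambda>(f, g). skein_class R (stack f g)) (A \<times> B)),
     ide = (\<lambda>n. skein_class R (replicate n Leaf))\<rparr>"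

text \<open>The element \<open>f \<circ> \<sigma>\<close> of \<open>\<F>\<^sup>V\<close> is the pair \<open>(f, \<sigma>)\<close>; elements of \<open>\<Sigma>\<^sub>n\<close> are the permutations of
  the naturals supported on \<open>{1..n}\<close>.  Composition is
  \<open>(f \<circ> \<sigma>) \<circ> (g \<circ> \<tau>) = (f \<circ> g\<^sup>\<sigma>) \<circ> (\<sigma>\<^sup>g \<circ> \<tau>)\<close>.\<close>

definition ForCV ::
  "('s tree \<times> 's tree) set \<Rightarrow> ('s forest set \<times> (nat \<Rightarrow> nat)) nat_category" where
  "ForCV R =
    \<lparr>mor = {(A, \<sigma>). A \<in> mor (ForC R) \<and> \<sigma> permutes {1..leaves (ForC R) A}},
     roots = (\<lambda>(A, \<sigma>). roots (ForC R) A),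
     leaves = (\<lambda>(A, \<sigma>). leaves (ForC R) A),
     cmp = (\<lambda>(A, \<sigma>) (B, \<tau>).
              (cmp (ForC R) A (on_class (\<lambda>g. skein_class R (permute_trees \<sigma> g)) B),
               on_class (permute_leaves \<sigma>) B \<circ> \<tau>)),
     ide = (\<lambda>n. (ide (ForC R) n, id))\<rparr>"

definition skein_trees :: "('s tree \<times> 's tree) set \<Rightarrow> 's forest set set" where
  "skein_trees R = {t \<in> mor (ForC R). roots (ForC R) t = 1}"


section \<open>Forest-skein groups\<close>

type_synonym 's fraction_elem =
  "(('s forest set \<times> (nat \<Rightarrow> nat)) \<times> ('s forest set \<times> (nat \<Rightarrow> nat))) set"

definition V_group :: "('s tree \<times> 's tree) set \<Rightarrow> 's fraction_elem monoid" where
  "V_group R = Frac (ForCV R) 1"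

definition tree_pairs ::
  "('s tree \<times> 's tree) set \<Rightarrow> ('s forest set \<times> (nat \<Rightarrow> nat) \<times> 's forest set) set" where
  "tree_pairs R = {(s, \<pi>, t). s \<in> skein_trees R \<and> t \<in> skein_trees R \<and>
     leaves (ForC R) s = leaves (ForC R) t \<and> \<pi> permutes {1..leaves (ForC R) t}}"

text \<open>\<open>V_elem R s \<pi> t\<close> is the element \<open>s \<circ> \<pi> \<circ> t\<^sup>-\<^sup>1\<close>.\<close>

definition V_elem ::
  "('s tree \<times> 's tree) set \<Rightarrow> 's forest set \<Rightarrow> (nat \<Rightarrow> nat) \<Rightarrow> 's forest set \<Rightarrow> 's fraction_elem" where
  "V_elem R s \<pi> t = fraction_class (ForCV R) 1 ((s, \<pi>), (t, id))"

definition rotation :: "nat \<Rightarrow> nat \<Rightarrow> nat" where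
  "rotation n j = (if j \<in> {1..n} then j mod n + 1 else j)"

text \<open>The subgroup of \<open>\<Sigma>\<^sub>n\<close> generated by \<open>rotation n\<close>; as this has finite order, nonnegative powers
  suffice.\<close>

definition cyclic_perms :: "nat \<Rightarrow> (nat \<Rightarrow> nat) set" where
  "cyclic_perms n = range (\<lambda>m. rotation n ^^ m)"

definition T_group :: "('s tree \<times> 's tree) set \<Rightarrow> 's fraction_elem set" where
  "T_group R = {g \<in> carrier (V_group R). \<exists>s \<pi> t. (s, \<pi>, t) \<in> tree_pairs R \<and>
     \<pi> \<in> cyclic_perms (leaves (ForC R) t) \<and> g = V_elem R s \<pi> t}"

definition F_group :: "('s tree \<times> 's tree) set \<Rightarrow> 's fraction_elem set" where
  "F_group R = {g \<in> carrier (V_group R). \<exists>s \<pi> t. (s, \<pi>, t) \<in> tree_pairs R \<and>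
     \<pi> = id \<and> g = V_elem R s \<pi> t}"


section \<open>The totally ordered set on which the V-group acts\<close>

definition pointed_trees :: "('s tree \<times> 's tree) set \<Rightarrow> ('s forest set \<times> nat) set" where
  "pointed_trees R = {(t, j). t \<in> skein_trees R \<and> j \<in> {1..leaves (ForC R) t}}"

definition pointed_step ::
  "('s tree \<times> 's tree) set \<Rightarrow> 's forest set \<times> nat \<Rightarrow> 's forest set \<times> nat \<Rightarrow> bool" where
  "pointed_step R = (\<lambda>(t, j) q. (t, j) \<in> pointed_trees R \<and>
     (\<exists>f\<in>mor (ForC R). leaves (ForC R) t = roots (ForC R) f \<and>
        q = (cmp (ForC R) t f, on_class (\<lambda>f'. first_leaf f' j) f)))"

definition X_class ::
  "('s tree \<times> 's tree) set \<Rightarrow> 's forest set \<Rightarrow> nat \<Rightarrow> ('s forest set \<times> nat) set" where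
  "X_class R t j = {q. equivclp (pointed_step R) (t, j) q}"

definition X_set :: "('s tree \<times> 's tree) set \<Rightarrow> ('s forest set \<times> nat) set set" where
  "X_set R = {X_class R t j | t j. (t, j) \<in> pointed_trees R}"

definition X_act :: "('s tree \<times> 's tree) set \<Rightarrow> 's fraction_elem \<Rightarrow>
    ('s forest set \<times> nat) set \<Rightarrow> ('s forest set \<times> nat) set" where
  "X_act R g x = the_elem {X_class R s (\<pi> j) | s \<pi> t j.
     (s, \<pi>, t) \<in> tree_pairs R \<and> (t, j) \<in> pointed_trees R \<and>
     g = V_elem R s \<pi> t \<and> x = X_class R t j}"

definition X_le :: "('s tree \<times> 's tree) set \<Rightarrow>
    ('s forest set \<times> nat) set \<Rightarrow> ('s forest set \<times> nat) set \<Rightarrow> bool" where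
  "X_le R x x' \<longleftrightarrow> (\<exists>t j t' j' f f'.
     (t, j) \<in> pointed_trees R \<and> (t', j') \<in> pointed_trees R \<and>
     x = X_class R t j \<and> x' = X_class R t' j' \<and>
     f \<in> mor (ForC R) \<and> f' \<in> mor (ForC R) \<and>
     leaves (ForC R) t = roots (ForC R) f \<and> leaves (ForC R) t' = roots (ForC R) f' \<and>
     cmp (ForC R) t f = cmp (ForC R) t' f' \<and>
     on_class (\<lambda>h. first_leaf h j) f \<le> on_class (\<lambda>h. first_leaf h j') f')"

end

theory Submission
  imports Defs
begin

text \<open>
  An element of the V-group is written \<open>s \<circ> \<pi> \<circ> t\<^sup>-\<^sup>1\<close> with trees \<open>s\<close>, \<open>t\<close>.  The points
  \<open>[t, 1], \<dots>, [t, n]\<close> form a chain, and \<open>s \<circ> \<pi> \<circ> t\<^sup>-\<^sup>1\<close> maps \<open>[t, i]\<close> to \<open>[s, \<pi> i]\<close>, so on this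
  chain the element is the permutation \<open>\<pi>\<close> (\<open>X_le_tree_pair\<close>).  This decides one half of each
  equality: an increasing permutation is the identity (\<open>monotone_permutation_id\<close>), and a permutation
  that becomes increasing after a cyclic permutation \<open>\<rho>\<close> is \<open>\<rho>\<^sup>-\<^sup>1\<close>, hence cyclic.

  For the other half, the Ore property allows finitely many points and the element to be rewritten
  over one large tree \<open>t f\<close> (\<open>V_elem_common_tree\<close>).  This replaces \<open>\<pi>\<close> by \<open>\<pi>\<^sup>f\<close>, which is
  the identity if \<open>\<pi>\<close> is, and is cyclic if \<open>\<pi>\<close> is: if trees in cyclic order are rotated, then so are
  their leaves (\<open>permute_leaves_rotation\<close>).  What is left is a
  statement on numbers: a rotation of \<open>{1..N}\<close> cuts any increasing sequence into two increasing
  pieces and exchanges them (\<open>cyclic_perm_rotates_chain\<close>).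

  All of this presupposes that points and fractions can be compared on representatives.  Refinement
  by a forest, of pointed trees as well as of fractions, is a transitive relation with the diamond
  property, by the Ore condition.  So two representatives of a class have a common refinement
  (\<open>equivclp_joinable\<close>), and left cancellation makes the comparison of leaf positions independent
  of the refinement (\<open>X_class_eq_fl\<close>).  For fractions, the diamond property requires that the
  composition of \<open>\<F>\<^sup>V\<close> is associative, which comes down to the identities
  \<open>(f g)\<^sup>\<sigma> = f\<^sup>\<sigma> g\<^bsup>\<sigma>^f\<^esup>\<close> and \<open>(\<sigma> \<rho>)\<^sup>f = \<sigma>\<^bsup>f^\<rho>\<^esup> \<rho>\<^sup>f\<close> and their
  companions for forests.
\<close>

text \<open>Positions count from 1, and every range is written \<open>{1..n}\<close>; rewriting \<open>1\<close> to \<open>Suc 0\<close> would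
  separate the two.\<close>

declare One_nat_def [simp del]

section \<open>Composition of forests and positions of leaves\<close>

lemma leaf_count_simps [simp]:
  "leaf_count [] = 0"
  "leaf_count (t # f) = size1 t + leaf_count f"
  "leaf_count (f @ g) = leaf_count f + leaf_count g"
  "leaf_count (replicate n Leaf) = n"
  by (simp_all add: leaf_count_def sum_list_replicate)

lemma size1_pos [simp]: "0 < size1 t"
  by (simp add: size1_size)

lemma stack_append:
  "stack (f @ f') g = stack f (take (leaf_count f) g) @ stack f' (drop (leaf_count f) g)"
  by (induction f arbitrary: g) (simp_all add: min_def drop_take add.commute)

lemma length_stack [simp]: "length (stack f g) = length f"
  by (induction f g rule: stack.induct) auto

lemma leaf_count_take_drop: "leaf_count (take n f) + leaf_count (drop n f) = leaf_count f"
  by (metis append_take_drop_id leaf_count_simps(3))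

lemma size1_graft: "length g = size1 t \<Longrightarrow> size1 (graft t g) = leaf_count g"
proof (induction t arbitrary: g)
  case Leaf
  then show ?case by (cases g) auto
next
  case (Node l a r)
  then show ?case by (simp add: leaf_count_take_drop)
qed

lemma leaf_count_stack [simp]:
  "length g = leaf_count f \<Longrightarrow> leaf_count (stack f g) = leaf_count g"
  by (induction f g rule: stack.induct) (auto simp: size1_graft leaf_count_take_drop)

lemma graft_graft:
  "length g = size1 t \<Longrightarrow> length h = leaf_count g \<Longrightarrow> graft (graft t g) h = graft t (stack g h)"
proof (induction t arbitrary: g h)
  case Leaf
  then show ?case by (cases g) auto
next
  case (Node l a r)
  define g1 g2 where "g1 = take (size1 l) g" and "g2 = drop (size1 l) g"
  have g: "g = g1 @ g2" "length g1 = size1 l" "length g2 = size1 r"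
    using Node.prems by (auto simp: g1_def g2_def)
  then show ?case
    using Node.prems Node.IH(1)[of g1 "take (leaf_count g1) h"]
      Node.IH(2)[of g2 "drop (leaf_count g1) h"]
    by (simp add: size1_graft stack_append)
qed

lemma stack_assoc:
  "length g = leaf_count f \<Longrightarrow> length h = leaf_count g \<Longrightarrow>
    stack (stack f g) h = stack f (stack g h)"
proof (induction f arbitrary: g h)
  case (Cons t f)
  define g1 g2 where "g1 = take (size1 t) g" and "g2 = drop (size1 t) g"
  have g: "g = g1 @ g2" "length g1 = size1 t" "length g2 = leaf_count f"
    using Cons.prems by (auto simp: g1_def g2_def)
  then show ?case
    using Cons.prems Cons.IH[of g2 "drop (leaf_count g1) h"]
    by (simp add: size1_graft stack_append graft_graft)
qed simp

lemma graft_Leaves: "graft t (replicate (size1 t) Leaf) = t"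
  by (induction t) (auto simp: take_replicate drop_replicate)

lemma stack_Leaves_right: "stack f (replicate (leaf_count f) Leaf) = f"
  by (induction f) (auto simp: graft_Leaves)

lemma nth_stack:
  "i < length f \<Longrightarrow>
    stack f g ! i = graft (f ! i) (take (size1 (f ! i)) (drop (leaf_count (take i f)) g))"
proof (induction f arbitrary: i g)
  case (Cons t f)
  then show ?case by (cases i) (auto simp: add.commute)
qed simp

lemma take_stack:
  "take i (stack f g) = stack (take i f) (take (leaf_count (take i f)) g)"
proof (induction f arbitrary: i g)
  case (Cons t f)
  then show ?case by (cases i) (auto simp: drop_take min_def)
qed simp

lemma first_leaf_stack:
  assumes "length g = leaf_count f"
  shows "first_leaf (stack f g) j = first_leaf g (first_leaf f j)"
proof -
  have "leaf_count (take (j - 1) f) \<le> length g"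
    using assms leaf_count_take_drop[of "j - 1" f] by simp
  then show ?thesis
    by (simp add: first_leaf_def take_stack)
qed

lemma first_leaf_Leaves: "j \<in> {1..n} \<Longrightarrow> first_leaf (replicate n Leaf) j = j"
  by (auto simp: first_leaf_def take_replicate)

lemma first_leaf_Suc:
  assumes "j \<in> {1..length f}"
  shows "first_leaf f (Suc j) = first_leaf f j + size1 (f ! (j - 1))"
proof -
  have "take j f = take (j - 1) f @ [f ! (j - 1)]"
    using assms take_Suc_conv_app_nth[of "j - 1" f] by auto
  then show ?thesis by (simp add: first_leaf_def)
qed

lemma first_leaf_mono: "i \<le> j \<Longrightarrow> first_leaf f i \<le> first_leaf f j"
proof -
  assume "i \<le> j"
  then have "take (j - 1) f = take (i - 1) f @ take (j - i) (drop (i - 1) f)" if "i \<ge> 1"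
    using that by (metis Nat.add_diff_assoc2 le_add_diff_inverse2 take_add add.commute)
  then show ?thesis
    by (cases "i \<ge> 1") (auto simp: first_leaf_def)
qed

lemma first_leaf_end: "first_leaf f (Suc (length f)) = Suc (leaf_count f)"
  by (simp add: first_leaf_def)

text \<open>Leaves are addressed by pairs: leaf \<open>k + 1\<close> of tree \<open>j\<close> is the leaf \<open>first_leaf f j + k\<close> of the
  forest.  The trees of \<open>f\<close> occupy consecutive intervals of positions, so each position has
  exactly one such address; this is what makes the description in \<open>permute_leaves\<close> definite.\<close>

lemma leaf_before_next_tree:
  assumes "j \<in> {1..length f}" "j < j'" "k < size1 (f ! (j - 1))"
  shows "first_leaf f j + k < first_leaf f j'"
  using first_leaf_Suc[OF assms(1)] first_leaf_mono[of "Suc j" j' f] assms by auto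

lemma leaf_position_range:
  assumes "j \<in> {1..length f}" "k < size1 (f ! (j - 1))"
  shows "first_leaf f j + k \<in> {1..leaf_count f}"
  using leaf_before_next_tree[of j f "Suc (length f)" k] assms first_leaf_end[of f]
  by (auto simp: first_leaf_def)

lemma first_leaf_range: "j \<in> {1..length f} \<Longrightarrow> first_leaf f j \<in> {1..leaf_count f}"
  using leaf_position_range[of j f 0] by simp

lemma first_leaf_less_iff:
  assumes "i \<in> {1..length f}" "j \<in> {1..length f}"
  shows "first_leaf f i < first_leaf f j \<longleftrightarrow> i < j"
  using leaf_before_next_tree[of i f j 0] first_leaf_mono[of j i f] assms by force

lemma leaf_position_unique:
  assumes "first_leaf f j + k = first_leaf f j' + k'"
    and "j \<in> {1..length f}" "k < size1 (f ! (j - 1))"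
    and "j' \<in> {1..length f}" "k' < size1 (f ! (j' - 1))"
  shows "j = j' \<and> k = k'"
proof -
  have "j = j'"
    using leaf_before_next_tree[of j f j' k] leaf_before_next_tree[of j' f j k'] assms
    by (cases j j' rule: linorder_cases) auto
  with assms show ?thesis by auto
qed

lemma leaf_position_cases:
  assumes "i \<in> {1..leaf_count f}"
  obtains j k where "j \<in> {1..length f}" "k < size1 (f ! (j - 1))" "i = first_leaf f j + k"
proof -
  have "\<exists>j k. j \<in> {1..length f} \<and> k < size1 (f ! (j - 1)) \<and> i = first_leaf f j + k"
    using assms
  proof (induction f rule: rev_induct)
    case (snoc t f)
    show ?case
    proof (cases "i \<le> leaf_count f")
      case True
      with snoc obtain j k where jk: "j \<in> {1..length f}" "k < size1 (f ! (j - 1))"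
        "i = first_leaf f j + k" by auto
      then have "j - 1 < length f" by auto
      with jk show ?thesis
        by (intro exI[of _ j] exI[of _ k]) (auto simp: nth_append first_leaf_def)
    next
      case False
      with snoc show ?thesis
        by (intro exI[of _ "Suc (length f)"] exI[of _ "i - Suc (leaf_count f)"])
          (auto simp: first_leaf_def)
    qed
  qed simp
  with that show thesis by blast
qed

section \<open>Permuting the trees of a forest\<close>

lemma length_permute_trees [simp]: "length (permute_trees \<sigma> f) = length f"
  by (simp add: permute_trees_def)

lemma nth_permute_trees:
  assumes "\<sigma> permutes {1..length f}" "j \<in> {1..length f}"
  shows "permute_trees \<sigma> f ! (\<sigma> j - 1) = f ! (j - 1)"
proof -
  have "\<sigma> j \<in> {1..length f}" "inv_into UNIV \<sigma> (\<sigma> j) = j"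
    using assms permutes_in_image[OF assms(1)] permutes_inverses(2)[OF assms(1)] by blast+
  then show ?thesis by (auto simp: permute_trees_def nth_upt simp del: upt_Suc)
qed

text \<open>A forest is \<open>f\<^sup>\<sigma>\<close> as soon as it has the trees of \<open>f\<close> at the positions \<open>\<sigma> j\<close>; this avoids the
  inverse of \<open>\<sigma>\<close> from here on.\<close>

lemma permute_trees_eqI:
  assumes \<sigma>: "\<sigma> permutes {1..length f}" and len: "length h = length f"
    and nth: "\<And>j. j \<in> {1..length f} \<Longrightarrow> h ! (\<sigma> j - 1) = f ! (j - 1)"
  shows "permute_trees \<sigma> f = h"
proof (rule nth_equalityI)
  fix i assume "i < length (permute_trees \<sigma> f)"
  then have "Suc i \<in> \<sigma> ` {1..length f}"
    by (simp add: permutes_image[OF \<sigma>])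
  then obtain j where j: "j \<in> {1..length f}" "\<sigma> j = Suc i" by force
  show "permute_trees \<sigma> f ! i = h ! i"
    using nth_permute_trees[OF \<sigma> j(1)] nth[OF j(1)] j(2) by simp
qed (simp add: len)

lemma permute_trees_id [simp]: "permute_trees id f = f"
  by (rule permute_trees_eqI) (simp_all add: permutes_id)

lemma permute_trees_comp:
  assumes "\<sigma> permutes {1..length f}" "\<rho> permutes {1..length f}"
  shows "permute_trees (\<sigma> \<circ> \<rho>) f = permute_trees \<sigma> (permute_trees \<rho> f)"
proof (rule permute_trees_eqI)
  fix j assume j: "j \<in> {1..length f}"
  then have "\<rho> j \<in> {1..length f}"
    using permutes_in_image[OF assms(2)] by blast
  then show "permute_trees \<sigma> (permute_trees \<rho> f) ! ((\<sigma> \<circ> \<rho>) j - 1) = f ! (j - 1)"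
    using nth_permute_trees[of \<sigma> "permute_trees \<rho> f" "\<rho> j"] nth_permute_trees[OF assms(2) j] assms(1)
    by simp
qed (use assms in \<open>auto intro: permutes_compose\<close>)

lemma permute_trees_Leaves:
  "\<sigma> permutes {1..n} \<Longrightarrow> permute_trees \<sigma> (replicate n Leaf) = replicate n Leaf"
proof (rule permute_trees_eqI)
  fix j assume \<sigma>: "\<sigma> permutes {1..n}" and j: "j \<in> {1..length (replicate n Leaf)}"
  then have "\<sigma> j \<in> {1..n}"
    using permutes_in_image[OF \<sigma>, of j] by simp
  with j show "(replicate n Leaf) ! (\<sigma> j - 1) = (replicate n Leaf) ! (j - 1)"
    by (subst (1 2) nth_replicate) auto
qed auto

lemma leaf_count_permute_trees [simp]:
  assumes "\<sigma> permutes {1..length f}"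
  shows "leaf_count (permute_trees \<sigma> f) = leaf_count f"
proof -
  have *: "leaf_count h = (\<Sum>j\<in>{1..length h}. size1 (h ! (j - 1)))" for h :: "'b tree list"
    unfolding leaf_count_def sum_list_sum_nth
    by (rule sum.reindex_bij_witness[of _ "\<lambda>j. j - 1" Suc]) auto
  have "leaf_count (permute_trees \<sigma> f)
      = (\<Sum>j\<in>{1..length f}. size1 (permute_trees \<sigma> f ! (\<sigma> j - 1)))"
    using sum.permute[OF assms, of "\<lambda>j. size1 (permute_trees \<sigma> f ! (j - 1))"] by (simp add: * o_def)
  also have "\<dots> = leaf_count f"
    unfolding * by (rule sum.cong) (simp_all add: nth_permute_trees[OF assms])
  finally show ?thesis .
qed

lemma permute_leaves_position:
  assumes "j \<in> {1..length f}" "k < size1 (f ! (j - 1))"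
  shows "permute_leaves \<sigma> f (first_leaf f j + k) = first_leaf (permute_trees \<sigma> f) (\<sigma> j) + k"
proof -
  have "(THE i'. \<exists>j'\<in>{1..length f}. \<exists>k' < size1 (f ! (j' - 1)).
             first_leaf f j + k = first_leaf f j' + k' \<and>
             i' = first_leaf (permute_trees \<sigma> f) (\<sigma> j') + k')
      = first_leaf (permute_trees \<sigma> f) (\<sigma> j) + k"
    using assms leaf_position_unique[of f j k] by (intro the_equality) blast+
  then show ?thesis
    using leaf_position_range[OF assms] by (simp add: permute_leaves_def)
qed

lemma permute_leaves_first_leaf:
  "j \<in> {1..length f} \<Longrightarrow>
    permute_leaves \<sigma> f (first_leaf f j) = first_leaf (permute_trees \<sigma> f) (\<sigma> j)"
  using permute_leaves_position[of j f 0 \<sigma>] by simp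

lemma permute_leaves_outside: "i \<notin> {1..leaf_count f} \<Longrightarrow> permute_leaves \<sigma> f i = i"
  unfolding permute_leaves_def by (rule if_not_P)

lemma permute_leaves_eqI:
  assumes "\<And>j k. j \<in> {1..length f} \<Longrightarrow> k < size1 (f ! (j - 1)) \<Longrightarrow>
      \<pi> (first_leaf f j + k) = first_leaf (permute_trees \<sigma> f) (\<sigma> j) + k"
    and "\<And>i. i \<notin> {1..leaf_count f} \<Longrightarrow> \<pi> i = i"
  shows "permute_leaves \<sigma> f = \<pi>"
proof
  fix i
  show "permute_leaves \<sigma> f i = \<pi> i"
  proof (cases "i \<in> {1..leaf_count f}")
    case True
    then obtain j k where "j \<in> {1..length f}" "k < size1 (f ! (j - 1))" "i = first_leaf f j + k"
      by (rule leaf_position_cases)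
    then show ?thesis using assms(1) permute_leaves_position by metis
  qed (simp add: assms(2) permute_leaves_outside)
qed

lemma permute_leaves_permutes:
  assumes "\<sigma> permutes {1..length f}"
  shows "permute_leaves \<sigma> f permutes {1..leaf_count f}"
proof (rule bij_imp_permutes)
  have range: "\<sigma> j \<in> {1..length f}" if "j \<in> {1..length f}" for j
    using that permutes_in_image[OF assms] by blast
  have "inj_on (permute_leaves \<sigma> f) {1..leaf_count f}"
  proof (rule inj_onI)
    fix i i' assume *: "i \<in> {1..leaf_count f}" "i' \<in> {1..leaf_count f}"
      "permute_leaves \<sigma> f i = permute_leaves \<sigma> f i'"
    obtain j k where jk: "j \<in> {1..length f}" "k < size1 (f ! (j - 1))" "i = first_leaf f j + k"
      using *(1) by (rule leaf_position_cases)
    obtain j' k' where jk': "j' \<in> {1..length f}" "k' < size1 (f ! (j' - 1))"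
      "i' = first_leaf f j' + k'"
      using *(2) by (rule leaf_position_cases)
    have "\<sigma> j = \<sigma> j' \<and> k = k'"
      using *(3) jk jk' range
      by (intro leaf_position_unique[of "permute_trees \<sigma> f"])
        (simp_all add: permute_leaves_position nth_permute_trees[OF assms])
    then show "i = i'"
      using jk(3) jk'(3) permutes_inj[OF assms] by (auto dest: injD)
  qed
  moreover have "permute_leaves \<sigma> f ` {1..leaf_count f} \<subseteq> {1..leaf_count f}"
  proof
    fix i' assume "i' \<in> permute_leaves \<sigma> f ` {1..leaf_count f}"
    then obtain i where i: "i \<in> {1..leaf_count f}" "i' = permute_leaves \<sigma> f i" by blast
    obtain j k where jk: "j \<in> {1..length f}" "k < size1 (f ! (j - 1))" "i = first_leaf f j + k"
      using i(1) by (rule leaf_position_cases)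
    then have "i' = first_leaf (permute_trees \<sigma> f) (\<sigma> j) + k"
      using i permute_leaves_position by metis
    then show "i' \<in> {1..leaf_count f}"
      using jk range[OF jk(1)] nth_permute_trees[OF assms jk(1)]
        leaf_position_range[of "\<sigma> j" "permute_trees \<sigma> f" k] assms by simp
  qed
  ultimately show "bij_betw (permute_leaves \<sigma> f) {1..leaf_count f} {1..leaf_count f}"
    by (simp add: bij_betw_def endo_inj_surj)
qed (simp add: permute_leaves_outside)

lemma permute_leaves_id [simp]: "permute_leaves id f = id"
  by (rule permute_leaves_eqI) simp_all

text \<open>The address of a leaf changes only in its tree, \<open>(j, k)\<close> becoming \<open>(\<rho> j, k)\<close> and then
  \<open>(\<sigma> (\<rho> j), k)\<close>; the second step takes place in \<open>f\<^sup>\<rho>\<close>.\<close>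

lemma permute_leaves_comp:
  assumes \<sigma>: "\<sigma> permutes {1..length f}" and \<rho>: "\<rho> permutes {1..length f}"
  shows "permute_leaves (\<sigma> \<circ> \<rho>) f = permute_leaves \<sigma> (permute_trees \<rho> f) \<circ> permute_leaves \<rho> f"
proof (rule permute_leaves_eqI)
  fix j k assume jk: "j \<in> {1..length f}" "k < size1 (f ! (j - 1))"
  then have "\<rho> j \<in> {1..length f}"
    using permutes_in_image[OF \<rho>] by blast
  then show "(permute_leaves \<sigma> (permute_trees \<rho> f) \<circ> permute_leaves \<rho> f) (first_leaf f j + k)
      = first_leaf (permute_trees (\<sigma> \<circ> \<rho>) f) ((\<sigma> \<circ> \<rho>) j) + k"
    using jk nth_permute_trees[OF \<rho> jk(1)]
    by (simp add: permute_leaves_position permute_trees_comp[OF \<sigma> \<rho>])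
qed (simp add: permute_leaves_outside \<rho>)

lemma permute_leaves_Leaves:
  assumes "\<sigma> permutes {1..n}"
  shows "permute_leaves \<sigma> (replicate n Leaf) = \<sigma>"
proof (rule permute_leaves_eqI)
  fix j k assume jk: "j \<in> {1..length (replicate n Leaf)}" "k < size1 (replicate n Leaf ! (j - 1))"
  then have "\<sigma> j \<in> {1..n}"
    using permutes_in_image[OF assms, of j] by simp
  with jk show "\<sigma> (first_leaf (replicate n Leaf) j + k)
      = first_leaf (permute_trees \<sigma> (replicate n Leaf)) (\<sigma> j) + k"
    by (simp add: permute_trees_Leaves[OF assms] first_leaf_Leaves del: atLeastAtMost_iff)
      (auto simp: first_leaf_Leaves)
qed (use permutes_not_in[OF assms] in auto)

text \<open>The leaves of tree \<open>j\<close> are moved as one block by \<open>\<sigma>\<^sup>f\<close>, in their order.  So the trees of \<open>g\<close>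
  standing on them are consecutive, and in the same order, in \<open>g\<close> permuted by \<open>\<sigma>\<^sup>f\<close>.  The case
  \<open>k = size1 (f ! (j - 1))\<close> gives the trees grafted on tree \<open>j\<close>, smaller \<open>k\<close> the leaves to the left
  of a given one.\<close>

lemma block_permute_trees:
  assumes \<sigma>: "\<sigma> permutes {1..length f}" and j: "j \<in> {1..length f}" and g: "length g = leaf_count f"
    and k: "k \<le> size1 (f ! (j - 1))"
  shows "take k (drop (first_leaf (permute_trees \<sigma> f) (\<sigma> j) - 1) (permute_trees (permute_leaves \<sigma> f) g))
      = take k (drop (first_leaf f j - 1) g)"
proof (rule nth_equalityI)
  have \<sigma>j: "\<sigma> j \<in> {1..length f}"
    using j permutes_in_image[OF \<sigma>] by blast
  let ?b = "first_leaf (permute_trees \<sigma> f) (\<sigma> j) - 1" and ?a = "first_leaf f j - 1"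
  have f1: "first_leaf h i = Suc (first_leaf h i - 1)" for h :: "'a forest" and i
    by (simp add: first_leaf_def)
  have a: "?a + i < leaf_count f" if "i < size1 (f ! (j - 1))" for i
    using leaf_position_range[OF j that] f1[of f j] by simp
  have b: "?b + i < leaf_count f" if "i < size1 (f ! (j - 1))" for i
    using leaf_position_range[of "\<sigma> j" "permute_trees \<sigma> f" i] \<sigma>j that nth_permute_trees[OF \<sigma> j] \<sigma>
      f1[of "permute_trees \<sigma> f" "\<sigma> j"] by simp
  have "?a + k \<le> leaf_count f" "?b + k \<le> leaf_count f"
    using a[of "k - 1"] b[of "k - 1"] a[of 0] b[of 0] k by (cases k; simp)+
  then show "length (take k (drop ?b (permute_trees (permute_leaves \<sigma> f) g)))
      = length (take k (drop ?a g))"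
    by (simp add: g)
  fix i assume "i < length (take k (drop ?b (permute_trees (permute_leaves \<sigma> f) g)))"
  then have ik: "i < k" by simp
  then have i: "i < size1 (f ! (j - 1))" using k by simp
  have "permute_trees (permute_leaves \<sigma> f) g ! (permute_leaves \<sigma> f (first_leaf f j + i) - 1)
      = g ! (first_leaf f j + i - 1)"
    using permute_leaves_permutes[OF \<sigma>] leaf_position_range[OF j i]
    by (intro nth_permute_trees) (simp_all add: g)
  then have "permute_trees (permute_leaves \<sigma> f) g ! (?b + i) = g ! (?a + i)"
    using permute_leaves_position[OF j i, of \<sigma>] f1[of f j] f1[of "permute_trees \<sigma> f" "\<sigma> j"] by simp
  then show "take k (drop ?b (permute_trees (permute_leaves \<sigma> f) g)) ! i = take k (drop ?a g) ! i"
    using ik a[OF i] b[OF i] by (simp add: g)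
qed

lemma permute_trees_stack:
  assumes \<sigma>: "\<sigma> permutes {1..length f}" and g: "length g = leaf_count f"
  shows "permute_trees \<sigma> (stack f g)
      = stack (permute_trees \<sigma> f) (permute_trees (permute_leaves \<sigma> f) g)"
proof (rule permute_trees_eqI)
  fix j assume "j \<in> {1..length (stack f g)}"
  then have j: "j \<in> {1..length f}" by simp
  then have "\<sigma> j \<in> {1..length f}" using permutes_in_image[OF \<sigma>] by blast
  moreover have "leaf_count (take (i - 1) h) = first_leaf h i - 1" for h :: "'a forest" and i
    by (simp add: first_leaf_def)
  ultimately show "stack (permute_trees \<sigma> f) (permute_trees (permute_leaves \<sigma> f) g) ! (\<sigma> j - 1)
      = stack f g ! (j - 1)"
    using block_permute_trees[OF \<sigma> j g order.refl] nth_permute_trees[OF \<sigma> j] j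
    by (subst (1 2) nth_stack) auto
qed (use \<sigma> in simp_all)

lemma first_leaf_add:
  "a \<ge> 1 \<Longrightarrow> first_leaf g (a + k) = first_leaf g a + leaf_count (take k (drop (a - 1) g))"
  using take_add[of "a - 1" k g] by (simp add: first_leaf_def)

text \<open>A leaf of \<open>f g\<close> has two addresses: tree \<open>m\<close> of \<open>g\<close> and offset \<open>l\<close>, where the leaf \<open>m\<close> of \<open>f\<close> has
  the address \<open>(j, k)\<close>; or tree \<open>j\<close> of \<open>f g\<close> and offset \<open>d + l\<close>, where \<open>d\<close> counts the leaves on the
  first \<open>k\<close> trees of \<open>g\<close> above tree \<open>j\<close>.  Both permutations keep this block together, so \<open>d\<close> is
  the same before and after.\<close>

lemma permute_leaves_stack:
  assumes \<sigma>: "\<sigma> permutes {1..length f}" and g: "length g = leaf_count f"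
  shows "permute_leaves \<sigma> (stack f g) = permute_leaves (permute_leaves \<sigma> f) g"
proof (rule HOL.sym, rule permute_leaves_eqI)
  fix m l assume m: "m \<in> {1..length g}" and l: "l < size1 (g ! (m - 1))"
  obtain j k where j: "j \<in> {1..length f}" and k: "k < size1 (f ! (j - 1))"
    and mjk: "m = first_leaf f j + k"
    using m unfolding g by (rule leaf_position_cases)
  let ?f' = "permute_trees \<sigma> f" and ?g' = "permute_trees (permute_leaves \<sigma> f) g"
  let ?d = "leaf_count (take k (drop (first_leaf f j - 1) g))"
  have fg: "first_leaf (stack f g) j + (?d + l) = first_leaf g m + l"
    by (simp add: first_leaf_stack[OF g] mjk first_leaf_add first_leaf_def[of f])
  have "first_leaf g m + l < first_leaf g (Suc m)"
    using leaf_before_next_tree[OF m _ l, of "Suc m"] by simp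
  also have "\<dots> \<le> first_leaf g (first_leaf f (Suc j))"
    using mjk k first_leaf_Suc[OF j] by (intro first_leaf_mono) simp
  also have "\<dots> = first_leaf (stack f g) j + size1 (stack f g ! (j - 1))"
    using first_leaf_Suc[of j "stack f g"] j by (simp add: first_leaf_stack[OF g])
  finally have dl: "?d + l < size1 (stack f g ! (j - 1))"
    using fg by simp
  have "permute_leaves \<sigma> (stack f g) (first_leaf g m + l)
      = first_leaf (permute_trees \<sigma> (stack f g)) (\<sigma> j) + (?d + l)"
    using permute_leaves_position[of j "stack f g" "?d + l" \<sigma>] j dl fg by simp
  also have "\<dots> = first_leaf ?g' (first_leaf ?f' (\<sigma> j)) + ?d + l"
    using first_leaf_stack[of ?g' ?f'] by (simp add: permute_trees_stack[OF \<sigma> g] g \<sigma>)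
  also have "\<dots> = first_leaf ?g' (first_leaf ?f' (\<sigma> j) + k) + l"
    using block_permute_trees[OF \<sigma> j g, of k] k
    by (subst first_leaf_add) (simp_all add: first_leaf_def[of ?f'])
  also have "\<dots> = first_leaf ?g' (permute_leaves \<sigma> f m) + l"
    by (simp add: mjk permute_leaves_position[OF j k])
  finally show "permute_leaves \<sigma> (stack f g) (first_leaf g m + l)
      = first_leaf ?g' (permute_leaves \<sigma> f m) + l" .
qed (simp add: permute_leaves_outside g)

section \<open>The forest-skein category\<close>

text \<open>The numbers of leaves of the trees of a composite depend only on those of its factors; they are
  the invariant through which length, leaf count, \<open>first_leaf\<close> and \<open>permute_leaves\<close> are
  well defined on skein classes.\<close>

lemma map_size1_stack_cong_right:
  "map size1 f = map size1 g \<Longrightarrow> leaf_count h = length f \<Longrightarrow>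
    map size1 (stack h f) = map size1 (stack h g)"
proof (induction h arbitrary: f g)
  case (Cons t h)
  have "size1 (graft t (take (size1 t) f)) = size1 (graft t (take (size1 t) g))"
    using Cons.prems map_eq_imp_length_eq[OF Cons.prems(1)]
    by (simp add: size1_graft leaf_count_def take_map[symmetric])
  with Cons show ?case by (simp add: drop_map[symmetric])
qed simp

lemma map_size1_stack_cong_left:
  "map size1 f = map size1 g \<Longrightarrow> leaf_count f = length h \<Longrightarrow>
    map size1 (stack f h) = map size1 (stack g h)"
proof (induction f arbitrary: g h)
  case (Cons t f)
  then obtain u g' where "g = u # g'" "size1 t = size1 u" "map size1 f = map size1 g'"
    by (auto simp: Cons_eq_map_conv)
  with Cons show ?case by (simp add: size1_graft)
qed simp

lemma leaf_count_cong: "map size1 f = map size1 g \<Longrightarrow> leaf_count f = leaf_count g"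
  by (simp add: leaf_count_def)

lemma first_leaf_cong: "map size1 f = map size1 g \<Longrightarrow> first_leaf f j = first_leaf g j"
  by (simp add: first_leaf_def leaf_count_def take_map[symmetric])

lemma permute_trees_rel:
  assumes "list_all2 P f g" "\<sigma> permutes {1..length f}"
  shows "list_all2 P (permute_trees \<sigma> f) (permute_trees \<sigma> g)"
proof -
  have "P (f ! (inv_into UNIV \<sigma> i - 1)) (g ! (inv_into UNIV \<sigma> i - 1))" if "i \<in> {1..length f}" for i
  proof -
    have "inv_into UNIV \<sigma> i \<in> {1..length f}"
      using that permutes_in_image[OF permutes_inv[OF assms(2)]] by blast
    then show ?thesis
      by (intro list_all2_nthD[OF assms(1)]) auto
  qed
  then show ?thesis
    using list_all2_lengthD[OF assms(1)]
    by (auto simp: permute_trees_def list_all2_conv_all_nth nth_upt simp del: upt_Suc)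
qed

lemma map_eq_list_all2: "map h f = map h g \<longleftrightarrow> list_all2 (\<lambda>t u. h t = h u) f g"
  by (auto simp: list_all2_conv_all_nth list_eq_iff_nth_eq)

lemma permute_leaves_cong:
  fixes f g :: "'s forest"
  assumes fg: "map size1 f = map size1 g" and \<sigma>: "\<sigma> permutes {1..length f}"
  shows "permute_leaves \<sigma> f = permute_leaves \<sigma> g"
proof (rule permute_leaves_eqI)
  fix j k assume jk: "j \<in> {1..length f}" "k < size1 (f ! (j - 1))"
  have "length f = length g" "size1 (f ! (j - 1)) = size1 (g ! (j - 1))"
    using fg jk(1) map_eq_imp_length_eq[OF fg] nth_map[of "j - 1" f size1] nth_map[of "j - 1" g size1]
    by auto
  moreover have "map size1 (permute_trees \<sigma> f) = map size1 (permute_trees \<sigma> g)"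
    using fg \<sigma> unfolding map_eq_list_all2 by (rule permute_trees_rel)
  ultimately show "permute_leaves \<sigma> g (first_leaf f j + k)
      = first_leaf (permute_trees \<sigma> f) (\<sigma> j) + k"
    using permute_leaves_position[of j g k \<sigma>] jk first_leaf_cong[OF fg]
      first_leaf_cong[of "permute_trees \<sigma> f" "permute_trees \<sigma> g"] by simp
qed (simp add: permute_leaves_outside leaf_count_cong[OF fg])

lemma skein_eq_componentwise:
  "list_all2 (\<lambda>t u. skein_eq R [t] [u]) f g \<Longrightarrow> skein_eq R f g"
proof (induction rule: list_all2_induct)
  case (Cons t f u g)
  have "skein_eq R ([t] @ f) ([u] @ f)" "skein_eq R ([u] @ f) ([u] @ g)"
    by (rule skein_eq.tensor_right skein_eq.tensor_left Cons)+
  then have "skein_eq R ([t] @ f) ([u] @ g)" by (rule skein_eq.trans)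
  then show ?case by simp
qed (rule skein_eq.refl)

locale skein_presentation =
  fixes R :: "('s tree \<times> 's tree) set"
  assumes same_leaves: "\<forall>(t, u) \<in> R. size1 t = size1 u"
begin

lemma skein_eq_sizes: "skein_eq R f g \<Longrightarrow> map size1 f = map size1 g"
proof (induction rule: skein_eq.induct)
  case (base t u)
  then show ?case using same_leaves by auto
next
  case (stack_left f g h)
  then show ?case by (intro map_size1_stack_cong_right)
next
  case (stack_right f g h)
  then show ?case by (intro map_size1_stack_cong_left)
qed simp_all

text \<open>Equivalence of forests can be checked tree by tree, because both sorts of composition act on the
  trees separately once the sizes are known to agree.  This is why permuting the trees respects
  equivalence, which the generating rules do not mention.\<close>

lemma skein_eq_iff_componentwise:
  "skein_eq R f g \<longleftrightarrow> list_all2 (\<lambda>t u. skein_eq R [t] [u]) f g"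
proof
  assume "skein_eq R f g"
  then show "list_all2 (\<lambda>t u. skein_eq R [t] [u]) f g"
  proof (induction rule: skein_eq.induct)
    case (base t u)
    then show ?case by (simp add: skein_eq.base)
  next
    case (refl f)
    show ?case by (simp add: list_all2_refl skein_eq.refl)
  next
    case (sym f g)
    then show ?case by (auto simp: list_all2_conv_all_nth intro: skein_eq.sym)
  next
    case (trans f g h)
    show ?case
      by (rule list_all2_trans[OF _ trans.IH]) (rule skein_eq.trans)
  next
    case (stack_left f g h)
    from stack_left.IH stack_left.hyps(2,3) show ?case
    proof (induction h arbitrary: f g)
      case (Cons t h)
      have "list_all2 (\<lambda>t u. skein_eq R [t] [u]) (take (size1 t) f) (take (size1 t) g)"
        "list_all2 (\<lambda>t u. skein_eq R [t] [u]) (drop (size1 t) f) (drop (size1 t) g)"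
        using Cons.prems(1) by simp_all
      then have "list_all2 (\<lambda>t u. skein_eq R [t] [u])
            (stack h (drop (size1 t) f)) (stack h (drop (size1 t) g))"
          "skein_eq R (take (size1 t) f) (take (size1 t) g)"
        using Cons.prems by (auto intro: Cons.IH skein_eq_componentwise)
      moreover have "skein_eq R (stack [t] (take (size1 t) f)) (stack [t] (take (size1 t) g))"
        using Cons.prems by (intro skein_eq.stack_left calculation(2)) simp_all
      ultimately show ?case by simp
    qed simp
  next
    case (stack_right f g h)
    from stack_right.IH stack_right.hyps(2) show ?case
    proof (induction arbitrary: h rule: list_all2_induct)
      case (Cons t f u g)
      have "size1 t = size1 u"
        using skein_eq_sizes[OF Cons.hyps(1)] by simp
      moreover have "skein_eq R (stack [t] (take (size1 t) h)) (stack [u] (take (size1 t) h))"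
        using Cons.prems Cons.hyps(1) calculation by (intro skein_eq.stack_right) auto
      ultimately show ?case
        using Cons.IH[of "drop (size1 t) h"] Cons.prems by simp
    qed simp
  qed (auto simp: list_all2_appendI list_all2_refl skein_eq.refl)
qed (rule skein_eq_componentwise)

lemma skein_eq_permute_trees:
  "skein_eq R f g \<Longrightarrow> \<sigma> permutes {1..length f} \<Longrightarrow>
    skein_eq R (permute_trees \<sigma> f) (permute_trees \<sigma> g)"
  unfolding skein_eq_iff_componentwise[of f] skein_eq_iff_componentwise[of "permute_trees \<sigma> f"]
  by (rule permute_trees_rel)

text \<open>For a class \<open>A\<close>, \<open>fl A j\<close> is \<open>j\<^sup>A\<close>, \<open>pt \<sigma> A\<close> is \<open>A\<^sup>\<sigma>\<close> and \<open>pl \<sigma> A\<close> is \<open>\<sigma>\<^sup>A\<close>.\<close>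

abbreviation cls where "cls \<equiv> skein_class R"
abbreviation Mor where "Mor \<equiv> mor (ForC R)"
abbreviation rts where "rts \<equiv> roots (ForC R)"
abbreviation lvs where "lvs \<equiv> leaves (ForC R)"
abbreviation comp (infixl "\<cdot>" 70) where "A \<cdot> B \<equiv> cmp (ForC R) A B"
abbreviation unit where "unit \<equiv> ide (ForC R)"
abbreviation fl where "fl A j \<equiv> on_class (\<lambda>f. first_leaf f j) A"
abbreviation pt where "pt \<sigma> A \<equiv> on_class (\<lambda>f. skein_class R (permute_trees \<sigma> f)) A"
abbreviation pl where "pl \<sigma> A \<equiv> on_class (permute_leaves \<sigma>) A"

lemma cls_eqI:
  assumes "skein_eq R f g"
  shows "cls f = cls g"
proof -
  have "skein_eq R f h \<longleftrightarrow> skein_eq R g h" for h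
    using skein_eq.trans[OF assms, of h] skein_eq.trans[OF skein_eq.sym[OF assms], of h] by blast
  then show ?thesis by (simp add: skein_class_def)
qed

lemma on_class_cls:
  assumes "\<And>g. skein_eq R f g \<Longrightarrow> \<phi> g = \<phi> f"
  shows "on_class \<phi> (cls f) = \<phi> f"
proof -
  have "\<phi> ` cls f = {\<phi> f}"
    using assms by (auto simp: skein_class_def intro: skein_eq.refl)
  then show ?thesis by (simp add: on_class_def)
qed

lemma cls_Mor [simp]: "cls f \<in> Mor"
  by (simp add: ForC_def)

lemma Mor_cases: "A \<in> Mor \<Longrightarrow> (\<And>f. A = cls f \<Longrightarrow> thesis) \<Longrightarrow> thesis"
  by (auto simp: ForC_def)

lemma rts_cls [simp]: "rts (cls f) = length f"
  unfolding ForC_def nat_category.simps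
  by (rule on_class_cls) (rule map_eq_imp_length_eq[OF skein_eq_sizes[OF skein_eq.sym]])

lemma lvs_cls [simp]: "lvs (cls f) = leaf_count f"
  unfolding ForC_def nat_category.simps
  by (rule on_class_cls) (rule leaf_count_cong[OF skein_eq_sizes[OF skein_eq.sym]])

lemma fl_cls [simp]: "fl (cls f) j = first_leaf f j"
  by (rule on_class_cls) (rule first_leaf_cong[OF skein_eq_sizes[OF skein_eq.sym]])

lemma pt_cls [simp]: "\<sigma> permutes {1..length f} \<Longrightarrow> pt \<sigma> (cls f) = cls (permute_trees \<sigma> f)"
  by (intro on_class_cls cls_eqI skein_eq.sym[OF skein_eq_permute_trees])

lemma pl_cls [simp]: "\<sigma> permutes {1..length f} \<Longrightarrow> pl \<sigma> (cls f) = permute_leaves \<sigma> f"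
  by (rule on_class_cls) (rule permute_leaves_cong[OF skein_eq_sizes, symmetric])

lemma comp_cls [simp]:
  assumes "leaf_count f = length g"
  shows "cls f \<cdot> cls g = cls (stack f g)"
proof -
  have "cls (stack f' g') = cls (stack f g)" if "skein_eq R f f'" "skein_eq R g g'" for f' g'
  proof (rule cls_eqI)
    have sizes: "leaf_count f = leaf_count f'" "length g = length g'"
      using skein_eq_sizes[OF that(1)] skein_eq_sizes[OF that(2)]
      by (auto intro: leaf_count_cong map_eq_imp_length_eq)
    have "skein_eq R (stack f' g') (stack f' g)" "skein_eq R (stack f' g) (stack f g)"
      using sizes assms that[THEN skein_eq.sym]
      by (simp_all add: skein_eq.stack_left skein_eq.stack_right)
    then show "skein_eq R (stack f' g') (stack f g)"
      by (rule skein_eq.trans)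
  qed
  then have "(\<lambda>(f, g). cls (stack f g)) ` (cls f \<times> cls g) = {cls (stack f g)}"
    by (auto simp: skein_class_def[of R f] skein_class_def[of R g] image_iff
        intro!: bexI[of _ "(f, g)"] skein_eq.refl)
  then show ?thesis by (simp add: ForC_def on_class_def)
qed

lemma unit_cls: "unit n = cls (replicate n Leaf)"
  by (simp add: ForC_def)

lemma comp_closed:
  assumes "A \<in> Mor" "B \<in> Mor" "lvs A = rts B"
  shows comp_Mor: "A \<cdot> B \<in> Mor" and rts_comp: "rts (A \<cdot> B) = rts A"
    and lvs_comp: "lvs (A \<cdot> B) = lvs B"
  using assms by (elim Mor_cases, simp)+

lemma comp_assoc:
  assumes "A \<in> Mor" "B \<in> Mor" "C \<in> Mor" "lvs A = rts B" "lvs B = rts C"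
  shows "A \<cdot> B \<cdot> C = A \<cdot> (B \<cdot> C)"
  using assms by (elim Mor_cases, simp add: stack_assoc)+

lemma unit_Mor [simp]: "unit n \<in> Mor" "rts (unit n) = n" "lvs (unit n) = n"
  by (simp_all add: unit_cls)

lemma comp_unit: "A \<in> Mor \<Longrightarrow> A \<cdot> unit (lvs A) = A"
  by (elim Mor_cases, simp add: unit_cls stack_Leaves_right)+

lemma fl_comp:
  assumes "A \<in> Mor" "B \<in> Mor" "lvs A = rts B"
  shows "fl (A \<cdot> B) j = fl B (fl A j)"
  using assms by (elim Mor_cases, simp add: first_leaf_stack)+

lemma fl_range: "A \<in> Mor \<Longrightarrow> j \<in> {1..rts A} \<Longrightarrow> fl A j \<in> {1..lvs A}"
  by (erule Mor_cases) (simp only: fl_cls lvs_cls rts_cls first_leaf_range)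

lemma fl_less_iff:
  "A \<in> Mor \<Longrightarrow> i \<in> {1..rts A} \<Longrightarrow> j \<in> {1..rts A} \<Longrightarrow> fl A i < fl A j \<longleftrightarrow> i < j"
  by (erule Mor_cases) (simp only: fl_cls rts_cls first_leaf_less_iff)

lemma fl_le_iff:
  "A \<in> Mor \<Longrightarrow> i \<in> {1..rts A} \<Longrightarrow> j \<in> {1..rts A} \<Longrightarrow> fl A i \<le> fl A j \<longleftrightarrow> i \<le> j"
  using fl_less_iff[of A j i] by linarith

lemma fl_eq_iff:
  "A \<in> Mor \<Longrightarrow> i \<in> {1..rts A} \<Longrightarrow> j \<in> {1..rts A} \<Longrightarrow> fl A i = fl A j \<longleftrightarrow> i = j"
  using fl_le_iff[of A i j] fl_le_iff[of A j i] by (auto intro: antisym)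

lemma fl_unit: "j \<in> {1..n} \<Longrightarrow> fl (unit n) j = j"
  by (simp only: unit_cls fl_cls first_leaf_Leaves)

lemma pt_closed:
  assumes "A \<in> Mor" "\<sigma> permutes {1..rts A}"
  shows pt_Mor: "pt \<sigma> A \<in> Mor" and rts_pt: "rts (pt \<sigma> A) = rts A"
    and lvs_pt: "lvs (pt \<sigma> A) = lvs A" and pl_permutes: "pl \<sigma> A permutes {1..lvs A}"
  using assms by (elim Mor_cases, simp add: permute_leaves_permutes)+

lemma pt_id: "A \<in> Mor \<Longrightarrow> pt id A = A" and pl_id: "A \<in> Mor \<Longrightarrow> pl id A = id"
  using pt_cls[OF permutes_id] pl_cls[OF permutes_id] by (elim Mor_cases, simp)+

lemma pt_unit: "\<sigma> permutes {1..n} \<Longrightarrow> pt \<sigma> (unit n) = unit n"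
  and pl_unit: "\<sigma> permutes {1..n} \<Longrightarrow> pl \<sigma> (unit n) = \<sigma>"
  by (simp_all add: unit_cls permute_trees_Leaves permute_leaves_Leaves)

lemma
  assumes "A \<in> Mor" "\<sigma> permutes {1..rts A}" "\<rho> permutes {1..rts A}"
  shows pt_comp: "pt (\<sigma> \<circ> \<rho>) A = pt \<sigma> (pt \<rho> A)"
    and pl_comp: "pl (\<sigma> \<circ> \<rho>) A = pl \<sigma> (pt \<rho> A) \<circ> pl \<rho> A"
  using assms by (auto elim!: Mor_cases simp: permute_trees_comp permute_leaves_comp permutes_compose)

lemma
  assumes "A \<in> Mor" "B \<in> Mor" "lvs A = rts B" "\<sigma> permutes {1..rts A}"
  shows pt_stack: "pt \<sigma> (A \<cdot> B) = pt \<sigma> A \<cdot> pt (pl \<sigma> A) B"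
    and pl_stack: "pl \<sigma> (A \<cdot> B) = pl (pl \<sigma> A) B"
proof -
  obtain f g where "A = cls f" "B = cls g" using assms by (elim Mor_cases)
  moreover from this have "permute_leaves \<sigma> f permutes {1..length g}"
    using assms permute_leaves_permutes[of \<sigma> f] by simp
  ultimately show "pt \<sigma> (A \<cdot> B) = pt \<sigma> A \<cdot> pt (pl \<sigma> A) B" "pl \<sigma> (A \<cdot> B) = pl (pl \<sigma> A) B"
    using assms by (simp_all add: permute_trees_stack permute_leaves_stack)
qed

lemma pl_fl:
  assumes "A \<in> Mor" "\<sigma> permutes {1..rts A}" "j \<in> {1..rts A}"
  shows "pl \<sigma> A (fl A j) = fl (pt \<sigma> A) (\<sigma> j)"
proof -
  obtain f where "A = cls f" using assms by (elim Mor_cases)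
  with assms show ?thesis by (simp add: permute_leaves_first_leaf)
qed

end

section \<open>Cyclic permutations and increasing sequences\<close>

lemma rotation_funpow:
  "(rotation n ^^ m) j = (if j \<in> {1..n} then (j - 1 + m) mod n + 1 else j)"
proof (induction m)
  case (Suc m)
  show ?case
  proof (cases "j \<in> {1..n}")
    case True
    then obtain i where i: "j = Suc i" by (cases j) auto
    have "(i + m) mod n < n" using True by simp
    then have "(i + m) mod n + 1 \<in> {1..n}" by simp
    then have "rotation n ((i + m) mod n + 1) = ((i + m) mod n + 1) mod n + 1"
      by (simp only: rotation_def if_True)
    with Suc True show ?thesis by (simp add: i mod_simps One_nat_def)
  qed (use Suc in \<open>auto simp: rotation_def\<close>)
qed auto

lemma cyclic_perms_comp:
  "\<pi> \<in> cyclic_perms n \<Longrightarrow> \<rho> \<in> cyclic_perms n \<Longrightarrow> \<pi> \<circ> \<rho> \<in> cyclic_perms n"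
  by (auto simp: cyclic_perms_def funpow_add[symmetric])

lemma id_cyclic_perms: "id \<in> cyclic_perms n"
  unfolding cyclic_perms_def by (rule image_eqI[of _ _ 0]) auto

lemma rotation_cyclic: "rotation n \<in> cyclic_perms n"
  unfolding cyclic_perms_def by (rule image_eqI[of _ _ 1]) (simp_all add: One_nat_def)

text \<open>The inverse of \<open>m\<close> rotations is \<open>m (n - 1)\<close> rotations, as \<open>n\<close> rotations are the identity.\<close>

lemma cyclic_perms_inverse:
  assumes "\<pi> \<in> cyclic_perms n"
  obtains \<rho> where "\<rho> \<in> cyclic_perms n" "\<pi> \<circ> \<rho> = id" "\<rho> \<circ> \<pi> = id"
proof -
  obtain m where \<pi>: "\<pi> = rotation n ^^ m"
    using assms by (auto simp: cyclic_perms_def)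
  have "(rotation n ^^ (m + m * (n - 1))) j = j" for j
  proof (cases "j \<in> {1..n}")
    case True
    then have "m + m * (n - 1) = m * n" by (cases n) auto
    moreover obtain i where "j = Suc i" using True by (cases j) auto
    ultimately show ?thesis using True by (simp add: rotation_funpow)
  qed (auto simp: rotation_funpow)
  then have "rotation n ^^ (m + m * (n - 1)) = id" by auto
  then have "\<pi> \<circ> (rotation n ^^ (m * (n - 1))) = id" "(rotation n ^^ (m * (n - 1))) \<circ> \<pi> = id"
    by (simp_all add: \<pi> funpow_add[symmetric] add.commute)
  then show thesis
    by (rule that[rotated]) (simp add: cyclic_perms_def)
qed

lemma cyclic_perms_permutes:
  assumes "\<pi> \<in> cyclic_perms n"
  shows "\<pi> permutes {1..n}"
proof -
  have "bij \<pi>"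
    using cyclic_perms_inverse[OF assms] o_bij by metis
  moreover have "\<forall>j. j \<notin> {1..n} \<longrightarrow> \<pi> j = j"
    using assms by (auto simp: cyclic_perms_def rotation_funpow)
  ultimately show ?thesis by (simp add: permutes_def bij_iff)
qed

text \<open>Rotating the trees by one moves the last tree to the front, hence all its leaves: this shifts the
  leaves cyclically by the size of the last tree.\<close>

lemma permute_leaves_rotation:
  "permute_leaves (rotation (length f)) f \<in> cyclic_perms (leaf_count f)"
proof (cases "f = []")
  case True
  then have "permute_leaves (rotation (length f)) f = id"
    by (intro permute_leaves_eqI) auto
  then show ?thesis by (simp add: id_cyclic_perms)
next
  case False
  let ?n = "length f" and ?N = "leaf_count f" and ?c = "size1 (last f)"
  have n: "?n \<ge> 1" using False by (simp add: Suc_leI One_nat_def)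
  have perm: "rotation ?n permutes {1..?n}"
    by (rule cyclic_perms_permutes[OF rotation_cyclic])
  have rotated: "permute_trees (rotation ?n) f = last f # butlast f"
  proof (rule permute_trees_eqI[OF perm])
    fix j assume j: "j \<in> {1..?n}"
    show "(last f # butlast f) ! (rotation ?n j - 1) = f ! (j - 1)"
    proof (cases "j = ?n")
      case False
      with j have "rotation ?n j = Suc j" "j < ?n" by (auto simp: rotation_def)
      then show ?thesis using j by (auto simp: nth_Cons' nth_butlast)
    qed (use False n in \<open>simp add: rotation_def last_conv_nth\<close>)
  qed (use n in simp)
  have N: "?N = leaf_count (butlast f) + ?c"
    using leaf_count_simps(3)[of "butlast f" "[last f]"] False by simp
  have last_tree: "first_leaf f ?n + ?c = Suc ?N"
    by (simp add: first_leaf_def N butlast_conv_take[symmetric])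
  have "permute_leaves (rotation ?n) f = rotation ?N ^^ ?c"
  proof (rule permute_leaves_eqI)
    fix j k assume j: "j \<in> {1..?n}" and k: "k < size1 (f ! (j - 1))"
    let ?p = "first_leaf f j + k"
    have p: "?p \<in> {1..?N}" using leaf_position_range[OF j k] .
    have "first_leaf (last f # butlast f) (rotation ?n j) + k = (?p - 1 + ?c) mod ?N + 1"
    proof (cases "j = ?n")
      case True
      then have "k < ?c" using k False by (simp add: last_conv_nth)
      moreover have "?p - 1 + ?c = ?N + k" using last_tree True p by simp
      ultimately have "(?p - 1 + ?c) mod ?N = k"
        using N by (simp only: mod_add_self1) simp
      then show ?thesis
        using True n by (simp add: rotation_def first_leaf_def)
    next
      case False
      with j have "rotation ?n j = Suc j" by (auto simp: rotation_def)
      moreover have "take (j - 1) (butlast f) = take (j - 1) f"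
        using j by (intro take_butlast) auto
      moreover have "?p + ?c \<le> ?N"
        using leaf_before_next_tree[OF j _ k, of ?n] False j last_tree by simp
      moreover have "take j (last f # butlast f) = last f # take (j - 1) (butlast f)"
        using j by (cases j) auto
      ultimately show ?thesis using p by (simp add: first_leaf_def)
    qed
    then show "(rotation ?N ^^ ?c) ?p
        = first_leaf (permute_trees (rotation ?n) f) (rotation ?n j) + k"
      using p by (simp add: rotated rotation_funpow)
  qed (auto simp: rotation_funpow)
  then show ?thesis by (auto simp: cyclic_perms_def)
qed

text \<open>Being injective, \<open>\<pi>\<close> is strictly increasing, so \<open>i \<le> \<pi> i\<close>; a permutation of \<open>{1..n}\<close> with this
  property fixes everything.\<close>

lemma monotone_permutation_id:
  fixes \<pi> :: "nat \<Rightarrow> nat"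
  assumes \<pi>: "\<pi> permutes {1..n}" and mono: "\<And>i. i \<in> {1..<n} \<Longrightarrow> \<pi> i \<le> \<pi> (i + 1)"
  shows "\<pi> = id"
proof (rule permutes_natset_ge[OF \<pi>], rule ballI)
  fix i assume "i \<in> {1..n}"
  then show "i \<le> \<pi> i"
  proof (induction i)
    case (Suc i)
    show ?case
    proof (cases "i = 0")
      case True
      then show ?thesis using permutes_in_image[OF \<pi>, of 1] Suc.prems by (simp add: One_nat_def)
    next
      case False
      with Suc.prems have "i \<in> {1..<n}" by simp
      moreover have "\<pi> i \<noteq> \<pi> (i + 1)"
        using permutes_inj[OF \<pi>] by (metis add_cancel_right_right injD one_neq_zero)
      moreover have "i \<le> \<pi> i" using Suc False by simp
      ultimately have "Suc i \<le> \<pi> (i + 1)" using mono[of i] by linarith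
      then show ?thesis by (simp only: Suc_eq_plus1)
    qed
  qed simp
qed

lemma mod_shift:
  fixes i k q :: nat
  assumes "i \<in> {1..k}" "q \<le> k"
  shows "(i - 1 + q) mod k + 1 = (if i + q \<le> k then i + q else i + q - k)"
proof (cases "i + q \<le> k")
  case False
  then have "i - 1 + q = k + (i + q - k - 1)" "i + q - k - 1 < k"
    using assms by auto
  then have "(i - 1 + q) mod k = i + q - k - 1"
    by (simp only: mod_add_self1 mod_less)
  with False show ?thesis by simp
qed (use assms in auto)

text \<open>The permutation \<open>\<pi>\<close> adds some \<open>c < N\<close> modulo \<open>N\<close>.  The first \<open>q\<close> members of the chain do not exceed
  \<open>N - c\<close> and are moved up by \<open>c\<close>, the others wrap around and are moved below them.  So the image
  becomes increasing when it is read from member \<open>q + 1\<close> on, that is, after \<open>q\<close> rotations.\<close>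

lemma cyclic_perm_rotates_chain:
  assumes \<pi>: "\<pi> \<in> cyclic_perms N"
    and range: "\<And>i. i \<in> {1..k} \<Longrightarrow> a i \<in> {1..N}"
    and mono: "\<And>i. i \<in> {1..<k} \<Longrightarrow> a i \<le> a (i + 1)"
  shows "\<exists>\<rho>\<in>cyclic_perms k. \<forall>i\<in>{1..<k}. \<pi> (a (\<rho> i)) \<le> \<pi> (a (\<rho> (i + 1)))"
proof -
  obtain m where m: "\<pi> = rotation N ^^ m"
    using \<pi> by (auto simp: cyclic_perms_def)
  define c where "c = m mod N"
  have \<pi>_a: "\<pi> (a i) = (if a i + c \<le> N then a i + c else a i + c - N)" if "i \<in> {1..k}" for i
  proof -
    have ai: "a i \<in> {1..N}" using range that by blast
    then have "c < N" by (simp add: c_def)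
    have "\<pi> (a i) = (a i - 1 + c) mod N + 1"
      using ai by (simp only: m rotation_funpow c_def mod_add_right_eq if_True)
    then show ?thesis
      using mod_shift[OF ai, of c] \<open>c < N\<close> by simp
  qed
  have mono': "a i \<le> a j" if "i \<in> {1..k}" "j \<in> {1..k}" "i \<le> j" for i j
    using that(3,1,2)
  proof (induction rule: dec_induct)
    case (step n)
    then have "a i \<le> a n" "a n \<le> a (n + 1)" using mono[of n] by simp_all
    then show ?case by (simp only: Suc_eq_plus1)
  qed simp
  \<comment> \<open>With 0 inserted the maximum also exists if every member of the chain wraps around.\<close>
  define q where "q = Max (insert 0 {i \<in> {1..k}. a i + c \<le> N})"
  have q_max: "i \<le> q" if "i \<in> {1..k}" "a i + c \<le> N" for i
    unfolding q_def by (rule Max_ge) (use that in auto)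
  have "q \<in> insert 0 {i \<in> {1..k}. a i + c \<le> N}"
    unfolding q_def by (rule Max_in) auto
  then have q: "q \<le> k" and q_mem: "q \<noteq> 0 \<Longrightarrow> a q + c \<le> N"
    by auto
  have threshold: "a i + c \<le> N \<longleftrightarrow> i \<le> q" if "i \<in> {1..k}" for i
  proof
    assume "i \<le> q"
    then have "a i \<le> a q" using mono'[of i q] that q by auto
    moreover have "q \<noteq> 0" using \<open>i \<le> q\<close> that by auto
    ultimately show "a i + c \<le> N" using q_mem by linarith
  qed (rule q_max[OF that])
  define \<rho> where "\<rho> = rotation k ^^ q"
  have \<rho>: "\<rho> i = (if i + q \<le> k then i + q else i + q - k)" if "i \<in> {1..k}" for i
    using mod_shift[OF that q] that by (simp only: \<rho>_def rotation_funpow if_True)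
  have "\<pi> (a (\<rho> i)) \<le> \<pi> (a (\<rho> (i + 1)))" if i: "i \<in> {1..<k}" for i
  proof -
    have ik: "i \<in> {1..k}" "i + 1 \<in> {1..k}" using i by auto
    consider "i + 1 + q \<le> k" | "i + q = k" | "i + q > k" by linarith
    then show ?thesis
    proof cases
      case 1
      define l where "l = i + q"
      have l: "l \<in> {1..k}" "l + 1 \<in> {1..k}" "\<not> l \<le> q" "l \<in> {1..<k}"
        using 1 i by (auto simp: l_def)
      have "\<rho> i = l" "\<rho> (i + 1) = l + 1"
        using 1 \<rho>[OF ik(1)] \<rho>[OF ik(2)] by (simp_all add: l_def)
      then show ?thesis
        using l mono[OF l(4)] threshold[OF l(1)] threshold[OF l(2)]
        by (simp add: \<pi>_a[OF l(1)] \<pi>_a[OF l(2)])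
    next
      \<comment> \<open>The last member, which wraps around, is followed by the first, which does not.\<close>
      case 2
      then have *: "k \<in> {1..k}" "1 \<in> {1..k}" "k > q" "1 \<le> q" using i by auto
      have "\<pi> (a k) = a k + c - N" "\<pi> (a 1) = a 1 + c"
        using * threshold[of k] threshold[of 1] by (simp_all add: \<pi>_a)
      moreover have "\<rho> i = k" "\<rho> (i + 1) = 1"
        using 2 \<rho>[OF ik(1)] \<rho>[OF ik(2)] by simp_all
      moreover have "a k \<le> N" using range[OF *(1)] by simp
      ultimately show ?thesis by (simp only:)
    next
      case 3
      define l where "l = i + q - k"
      have l: "l \<in> {1..k}" "l + 1 \<in> {1..k}" "l + 1 \<le> q" "l \<in> {1..<k}"
        using 3 i q by (auto simp: l_def)
      have "\<rho> i = l" "\<rho> (i + 1) = l + 1"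
        using 3 \<rho>[OF ik(1)] \<rho>[OF ik(2)] by (simp_all add: l_def)
      then show ?thesis
        using l mono[OF l(4)] threshold[OF l(1)] threshold[OF l(2)]
        by (simp add: \<pi>_a[OF l(1)] \<pi>_a[OF l(2)])
    qed
  qed
  moreover have "\<rho> \<in> cyclic_perms k" by (simp add: \<rho>_def cyclic_perms_def)
  ultimately show ?thesis by blast
qed

lemma (in skein_presentation) pl_cyclic:
  assumes A: "A \<in> Mor" and \<pi>: "\<pi> \<in> cyclic_perms (rts A)"
  shows "pl \<pi> A \<in> cyclic_perms (lvs A)"
proof -
  let ?n = "rts A"
  have perm: "rotation ?n ^^ m permutes {1..?n}" for m
    by (rule cyclic_perms_permutes) (simp add: cyclic_perms_def)
  have perm1: "rotation ?n permutes {1..?n}"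
    by (rule cyclic_perms_permutes[OF rotation_cyclic])
  have step: "pl (rotation ?n) B \<in> cyclic_perms (lvs B)" if "B \<in> Mor" "rts B = ?n" for B
  proof -
    obtain f where "B = cls f" using \<open>B \<in> Mor\<close> by (elim Mor_cases)
    with that perm1 show ?thesis
      using permute_leaves_rotation[of f] by simp
  qed
  have "pl (rotation ?n ^^ m) A \<in> cyclic_perms (lvs A)" for m
  proof (induction m)
    case 0
    show ?case by (simp only: funpow.simps pl_id[OF A] id_cyclic_perms)
  next
    case (Suc m)
    have "pl (rotation ?n ^^ Suc m) A
        = pl (rotation ?n) (pt (rotation ?n ^^ m) A) \<circ> pl (rotation ?n ^^ m) A"
      using pl_comp[OF A _ perm[of m], of "rotation ?n"] perm1 by simp
    moreover have "pl (rotation ?n) (pt (rotation ?n ^^ m) A) \<in> cyclic_perms (lvs A)"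
      using step[of "pt (rotation ?n ^^ m) A"] pt_closed[OF A perm[of m]] by simp
    ultimately show ?case using cyclic_perms_comp[OF _ Suc] by (simp only:)
  qed
  with \<pi> show ?thesis by (auto simp: cyclic_perms_def)
qed

section \<open>Confluence of refinement\<close>

text \<open>A transitive relation with the diamond property: every zigzag can be straightened to a common
  successor.  Reflexivity at the start covers the zigzag of length 0.\<close>

lemma equivclp_joinable:
  assumes "equivclp r a b" and "r a a"
    and trans: "\<And>x y z. r x y \<Longrightarrow> r y z \<Longrightarrow> r x z"
    and diamond: "\<And>x y z. r x y \<Longrightarrow> r x z \<Longrightarrow> \<exists>w. r y w \<and> r z w"
  shows "\<exists>c. r a c \<and> r b c"
  using assms(1)
proof (induction rule: equivclp_induct)
  case base
  show ?case using \<open>r a a\<close> by blast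
next
  case (step y z)
  then obtain c where "r a c" "r y c" by blast
  with step.hyps(2) show ?case using trans diamond by blast
qed

lemma equivclp_class_eq_iff:
  "{x. equivclp r a x} = {x. equivclp r b x} \<longleftrightarrow> equivclp r a b"
proof
  assume "{x. equivclp r a x} = {x. equivclp r b x}"
  then show "equivclp r a b" using equivclp_refl[of r b] by blast
next
  assume "equivclp r a b"
  then show "{x. equivclp r a x} = {x. equivclp r b x}"
    using equivclp_trans[of r] equivclp_sym[of r] by blast
qed

lemma X_class_eq_iff: "X_class R t i = X_class R t' i' \<longleftrightarrow> equivclp (pointed_step R) (t, i) (t', i')"
  unfolding X_class_def by (rule equivclp_class_eq_iff)

lemma V_elem_eq_iff:
  "V_elem R s \<pi> t = V_elem R s' \<pi>' t' \<longleftrightarrow>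
    equivclp (fraction_step (ForCV R) 1) ((s, \<pi>), (t, id)) ((s', \<pi>'), (t', id))"
  unfolding V_elem_def fraction_class_def by (rule equivclp_class_eq_iff)

context skein_presentation
begin

abbreviation MorV where "MorV \<equiv> mor (ForCV R)"
abbreviation compV (infixl "\<bullet>" 70) where "F \<bullet> G \<equiv> cmp (ForCV R) F G"

lemma MorV_iff [simp]: "(A, \<sigma>) \<in> MorV \<longleftrightarrow> A \<in> Mor \<and> \<sigma> permutes {1..lvs A}"
  and rootsV [simp]: "roots (ForCV R) (A, \<sigma>) = rts A"
  and leavesV [simp]: "leaves (ForCV R) (A, \<sigma>) = lvs A"
  and compV [simp]: "(A, \<sigma>) \<bullet> (B, \<tau>) = (A \<cdot> pt \<sigma> B, pl \<sigma> B \<circ> \<tau>)"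
  by (simp_all add: ForCV_def)

lemma compV_closed:
  assumes "F \<in> MorV" "G \<in> MorV" "leaves (ForCV R) F = roots (ForCV R) G"
  shows "F \<bullet> G \<in> MorV \<and> roots (ForCV R) (F \<bullet> G) = roots (ForCV R) F
    \<and> leaves (ForCV R) (F \<bullet> G) = leaves (ForCV R) G"
proof (cases F, cases G)
  fix A \<sigma> B \<tau> assume FG: "F = (A, \<sigma>)" "G = (B, \<tau>)"
  with assms have "A \<in> Mor" "B \<in> Mor" "\<sigma> permutes {1..rts B}" "\<tau> permutes {1..lvs B}"
    "lvs A = rts B" by auto
  then show ?thesis
    using pt_closed[of B \<sigma>] comp_closed[of A "pt \<sigma> B"] by (simp add: FG permutes_compose)
qed

text \<open>On forests this is \<open>(f g)\<^sup>\<sigma> = f\<^sup>\<sigma> g\<^bsup>\<sigma>^f\<^esup>\<close>, on permutations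
  \<open>(\<sigma> \<rho>)\<^sup>h = \<sigma>\<^bsup>h^\<rho>\<^esup> \<rho>\<^sup>h\<close>, together with the compatibility of both operations with
  composition.\<close>

lemma compV_assoc:
  assumes "F \<in> MorV" "G \<in> MorV" "H \<in> MorV"
    "leaves (ForCV R) F = roots (ForCV R) G" "leaves (ForCV R) G = roots (ForCV R) H"
  shows "F \<bullet> G \<bullet> H = F \<bullet> (G \<bullet> H)"
proof (cases F, cases G, cases H)
  fix A \<sigma> B \<rho> C \<kappa> assume FGH: "F = (A, \<sigma>)" "G = (B, \<rho>)" "H = (C, \<kappa>)"
  with assms have m: "A \<in> Mor" "B \<in> Mor" "C \<in> Mor" "lvs A = rts B" "lvs B = rts C"
    and \<sigma>: "\<sigma> permutes {1..rts B}" and \<rho>: "\<rho> permutes {1..rts C}" by auto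
  have \<sigma>B: "pl \<sigma> B permutes {1..rts C}"
    using pl_permutes[OF m(2) \<sigma>] m by simp
  have C\<rho>: "pt \<rho> C \<in> Mor" "rts (pt \<rho> C) = rts C"
    using pt_closed[OF m(3) \<rho>] by auto
  have "A \<cdot> pt \<sigma> B \<cdot> pt (pl \<sigma> B \<circ> \<rho>) C = A \<cdot> pt \<sigma> (B \<cdot> pt \<rho> C)"
    using m C\<rho> \<sigma>B pt_closed[OF m(2) \<sigma>] pt_closed[of "pt \<rho> C" "pl \<sigma> B"]
    by (simp add: pt_comp[OF m(3) \<sigma>B \<rho>] pt_stack[of B _ \<sigma>] \<sigma> comp_assoc)
  moreover have "pl (pl \<sigma> B \<circ> \<rho>) C = pl \<sigma> (B \<cdot> pt \<rho> C) \<circ> pl \<rho> C"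
    using m C\<rho> by (simp add: pl_comp[OF m(3) \<sigma>B \<rho>] pl_stack[of B _ \<sigma>] \<sigma>)
  ultimately show ?thesis
    by (simp add: FGH o_assoc)
qed

lemma compV_unit:
  assumes "F \<in> MorV"
  shows "F \<bullet> (unit (leaves (ForCV R) F), id) = F"
proof (cases F)
  case (Pair A \<sigma>)
  with assms show ?thesis by (simp add: pt_unit pl_unit comp_unit)
qed

lemma fractionsI:
  "F \<in> MorV \<Longrightarrow> G \<in> MorV \<Longrightarrow> roots (ForCV R) F = a \<Longrightarrow> roots (ForCV R) G = a \<Longrightarrow>
    leaves (ForCV R) F = leaves (ForCV R) G \<Longrightarrow> (F, G) \<in> fractions (ForCV R) a"
  by (simp add: fractions_def)

lemma fraction_step_iff:
  "fraction_step (ForCV R) a (F, G) q \<longleftrightarrow> (F, G) \<in> fractions (ForCV R) a \<and>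
    (\<exists>H\<in>MorV. leaves (ForCV R) F = roots (ForCV R) H \<and> q = (F \<bullet> H, G \<bullet> H))"
  by (simp add: fraction_step_def)

lemma fraction_step_comp:
  assumes "(F, G) \<in> fractions (ForCV R) a" "H \<in> MorV" "leaves (ForCV R) F = roots (ForCV R) H"
    "K \<in> MorV" "leaves (ForCV R) H = roots (ForCV R) K"
  shows "fraction_step (ForCV R) a (F \<bullet> H, G \<bullet> H) (F \<bullet> (H \<bullet> K), G \<bullet> (H \<bullet> K))"
proof -
  have FG: "F \<in> MorV" "G \<in> MorV" "leaves (ForCV R) G = roots (ForCV R) H"
    "roots (ForCV R) F = a" "roots (ForCV R) G = a"
    using assms by (auto simp: fractions_def)
  show ?thesis
    unfolding fraction_step_iff
    using FG assms compV_closed[of F H] compV_closed[of G H]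
    by (intro conjI bexI[of _ K]) (auto intro!: fractionsI simp: compV_assoc simp del: compV)
qed

lemma fraction_step_trans:
  assumes "fraction_step (ForCV R) a x y" "fraction_step (ForCV R) a y z"
  shows "fraction_step (ForCV R) a x z"
proof -
  obtain F G where x: "x = (F, G)" by (cases x)
  obtain H where H: "(F, G) \<in> fractions (ForCV R) a" "H \<in> MorV"
    "leaves (ForCV R) F = roots (ForCV R) H" "y = (F \<bullet> H, G \<bullet> H)"
    using assms(1) by (auto simp: x fraction_step_iff simp del: compV)
  obtain K where K: "K \<in> MorV" "leaves (ForCV R) (F \<bullet> H) = roots (ForCV R) K"
    "z = (F \<bullet> H \<bullet> K, G \<bullet> H \<bullet> K)"
    using assms(2) by (auto simp: H(4) fraction_step_iff simp del: compV)
  have FG: "F \<in> MorV" "G \<in> MorV" "leaves (ForCV R) G = roots (ForCV R) H"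
    using H by (auto simp: fractions_def)
  have HK: "leaves (ForCV R) H = roots (ForCV R) K"
    using compV_closed[OF FG(1) H(2,3)] K by simp
  have "z = (F \<bullet> (H \<bullet> K), G \<bullet> (H \<bullet> K))"
    using compV_assoc[OF FG(1) H(2) K(1) H(3) HK] compV_assoc[OF FG(2) H(2) K(1) FG(3) HK] K(3)
    by simp
  then show ?thesis
    unfolding x fraction_step_iff
    using compV_closed[OF H(2) K(1) HK] H(1,3) by (intro conjI bexI[of _ "H \<bullet> K"]) auto
qed

lemma pointed_step_iff:
  "pointed_step R (t, j) q \<longleftrightarrow> (t, j) \<in> pointed_trees R \<and>
     (\<exists>f\<in>Mor. lvs t = rts f \<and> q = (t \<cdot> f, fl f j))"
  by (simp add: pointed_step_def)

lemma skein_trees_iff: "t \<in> skein_trees R \<longleftrightarrow> t \<in> Mor \<and> rts t = 1"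
  by (simp add: skein_trees_def)

lemma pointed_trees_iff:
  "(t, j) \<in> pointed_trees R \<longleftrightarrow> t \<in> Mor \<and> rts t = 1 \<and> j \<in> {1..lvs t}"
  by (simp add: pointed_trees_def skein_trees_iff)

lemma pointed_trees_comp:
  assumes "(t, j) \<in> pointed_trees R" "f \<in> Mor" "lvs t = rts f"
  shows "(t \<cdot> f, fl f j) \<in> pointed_trees R"
proof -
  have t: "t \<in> Mor" "rts t = 1" "j \<in> {1..rts f}"
    using assms(1,3) by (simp_all add: pointed_trees_iff)
  then show ?thesis
    using fl_range[OF assms(2) t(3)] comp_closed[OF t(1) assms(2,3)]
    by (simp only: pointed_trees_iff)
qed

lemma pointed_step_trans:
  assumes "pointed_step R x y" "pointed_step R y z"
  shows "pointed_step R x z"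
proof -
  obtain t j where x: "x = (t, j)" by (cases x)
  obtain f where f: "(t, j) \<in> pointed_trees R" "f \<in> Mor" "lvs t = rts f" "y = (t \<cdot> f, fl f j)"
    using assms(1) by (auto simp: x pointed_step_iff)
  obtain g where g: "g \<in> Mor" "lvs (t \<cdot> f) = rts g" "z = (t \<cdot> f \<cdot> g, fl g (fl f j))"
    using assms(2) by (auto simp: f(4) pointed_step_iff)
  have t: "t \<in> Mor" using f(1) by (simp add: pointed_trees_iff)
  have fg: "lvs f = rts g" using g(2) lvs_comp[OF t f(2,3)] by simp
  then have "z = (t \<cdot> (f \<cdot> g), fl (f \<cdot> g) j)"
    using t f g by (simp add: comp_assoc fl_comp)
  then show ?thesis
    unfolding x pointed_step_iff
    using f g(1) comp_closed[OF f(2) g(1) fg] by (intro conjI bexI[of _ "f \<cdot> g"]) auto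
qed

end

locale ore_skein_presentation = skein_presentation +
  assumes ore: "ore_category (ForC R)"
begin

lemma common_refinement:
  assumes "f \<in> Mor" "g \<in> Mor" "rts f = rts g"
  obtains p q where "p \<in> Mor" "q \<in> Mor" "lvs f = rts p" "lvs g = rts q" "f \<cdot> p = g \<cdot> q"
proof -
  have "\<exists>p\<in>Mor. \<exists>q\<in>Mor. lvs f = rts p \<and> lvs g = rts q \<and> f \<cdot> p = g \<cdot> q"
    using ore[unfolded ore_category_def, THEN conjunct2, rule_format, OF assms] .
  then show thesis using that by blast
qed

lemma comp_left_cancel:
  assumes "f \<in> Mor" "p \<in> Mor" "q \<in> Mor" "lvs f = rts p" "lvs f = rts q" "f \<cdot> p = f \<cdot> q"
  shows "p = q"
  using ore[unfolded ore_category_def left_cancellative_def, THEN conjunct1, rule_format,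
      OF assms(1-3)] assms(4-6) by simp

text \<open>A common refinement \<open>A p = B q\<close> of the forests lifts to \<open>\<F>\<^sup>V\<close>: composing \<open>A \<circ> \<sigma>\<close> with \<open>p\<close> permuted
  by \<open>\<sigma>\<^sup>-\<^sup>1\<close> gives the forest \<open>A p\<close>, and the permutation left over can be cancelled by a further
  permutation.\<close>

lemma compV_common_refinement:
  assumes "F \<in> MorV" "G \<in> MorV" "roots (ForCV R) F = roots (ForCV R) G"
  shows "\<exists>P Q. P \<in> MorV \<and> Q \<in> MorV \<and> leaves (ForCV R) F = roots (ForCV R) P \<and>
    leaves (ForCV R) G = roots (ForCV R) Q \<and> F \<bullet> P = G \<bullet> Q"
proof -
  have lift: "\<exists>P. P \<in> MorV \<and> leaves (ForCV R) (A, \<sigma>) = roots (ForCV R) P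
      \<and> (A, \<sigma>) \<bullet> P = (A \<cdot> p, id)"
    if "(A, \<sigma>) \<in> MorV" "p \<in> Mor" "lvs A = rts p" for A \<sigma> p
  proof -
    have \<sigma>: "\<sigma> permutes {1..rts p}" using that by simp
    let ?\<sigma>' = "inv_into UNIV \<sigma>"
    let ?p = "pt ?\<sigma>' p"
    have \<sigma>': "?\<sigma>' permutes {1..rts p}" using permutes_inv[OF \<sigma>] .
    note p = pt_closed[OF that(2) \<sigma>']
    have "pt \<sigma> ?p = p"
      using pt_comp[OF that(2) \<sigma> \<sigma>'] permutes_inv_o(1)[OF \<sigma>] pt_id[OF that(2)] by simp
    moreover have perm: "pl \<sigma> ?p permutes {1..lvs p}"
      using pl_permutes[of ?p \<sigma>] p \<sigma> by simp
    ultimately have "(A, \<sigma>) \<bullet> (?p, inv_into UNIV (pl \<sigma> ?p)) = (A \<cdot> p, id)"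
      using permutes_inv_o(1)[OF perm] by simp
    then show ?thesis
      using p that permutes_inv[OF perm]
      by (intro exI[of _ "(?p, inv_into UNIV (pl \<sigma> ?p))"]) simp
  qed
  obtain A \<sigma> B \<tau> where FG: "F = (A, \<sigma>)" "G = (B, \<tau>)" by (cases F, cases G)
  obtain p q where "p \<in> Mor" "q \<in> Mor" "lvs A = rts p" "lvs B = rts q" "A \<cdot> p = B \<cdot> q"
    using assms common_refinement[of A B] by (auto simp: FG)
  with lift[of A \<sigma> p] lift[of B \<tau> q] assms show ?thesis
    unfolding FG by metis
qed

lemma fraction_step_diamond:
  assumes "fraction_step (ForCV R) a x y" "fraction_step (ForCV R) a x z"
  shows "\<exists>w. fraction_step (ForCV R) a y w \<and> fraction_step (ForCV R) a z w"
proof -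
  obtain F G where x: "x = (F, G)" by (cases x)
  obtain H where H: "(F, G) \<in> fractions (ForCV R) a" "H \<in> MorV"
    "leaves (ForCV R) F = roots (ForCV R) H" "y = (F \<bullet> H, G \<bullet> H)"
    using assms(1) by (auto simp: x fraction_step_iff simp del: compV)
  obtain K where K: "K \<in> MorV" "leaves (ForCV R) F = roots (ForCV R) K" "z = (F \<bullet> K, G \<bullet> K)"
    using assms(2) by (auto simp: x fraction_step_iff simp del: compV)
  obtain P Q where PQ: "P \<in> MorV" "Q \<in> MorV" "leaves (ForCV R) H = roots (ForCV R) P"
    "leaves (ForCV R) K = roots (ForCV R) Q" "H \<bullet> P = K \<bullet> Q"
    using compV_common_refinement[OF H(2) K(1)] H(3) K(2) by auto
  show ?thesis
    using fraction_step_comp[OF H(1-3) PQ(1,3)] fraction_step_comp[OF H(1) K(1,2) PQ(2,4)]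
    unfolding H(4) K(3) PQ(5) by blast
qed

lemma pointed_step_diamond:
  assumes "pointed_step R x y" "pointed_step R x z"
  shows "\<exists>w. pointed_step R y w \<and> pointed_step R z w"
proof -
  obtain t j where x: "x = (t, j)" by (cases x)
  obtain f where f: "(t, j) \<in> pointed_trees R" "f \<in> Mor" "lvs t = rts f" "y = (t \<cdot> f, fl f j)"
    using assms(1) by (auto simp: x pointed_step_iff)
  obtain g where g: "g \<in> Mor" "lvs t = rts g" "z = (t \<cdot> g, fl g j)"
    using assms(2) by (auto simp: x pointed_step_iff)
  have t: "t \<in> Mor" using f(1) by (simp add: pointed_trees_iff)
  obtain p q where pq: "p \<in> Mor" "q \<in> Mor" "lvs f = rts p" "lvs g = rts q" "f \<cdot> p = g \<cdot> q"
    using common_refinement[OF f(2) g(1)] f(3) g(2) by auto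
  have "t \<cdot> f \<cdot> p = t \<cdot> g \<cdot> q" "fl p (fl f j) = fl q (fl g j)"
    using t f g pq fl_comp[of f p j] fl_comp[of g q j] by (simp_all add: comp_assoc)
  then have "pointed_step R y (t \<cdot> f \<cdot> p, fl p (fl f j))" "pointed_step R z (t \<cdot> f \<cdot> p, fl p (fl f j))"
    using t f g pq pointed_trees_comp[OF f(1-3)] pointed_trees_comp[OF f(1) g(1,2)]
    by (auto simp: pointed_step_iff lvs_comp)
  then show ?thesis by blast
qed

section \<open>The ordered set\<close>

lemma X_class_joinable:
  assumes "X_class R t i = X_class R t' i'" "(t, i) \<in> pointed_trees R"
  obtains f f' where "f \<in> Mor" "f' \<in> Mor" "lvs t = rts f" "lvs t' = rts f'"
    "t \<cdot> f = t' \<cdot> f'" "fl f i = fl f' i'"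
proof -
  have "pointed_step R (t, i) (t, i)"
    using assms(2) by (auto simp: pointed_step_iff pointed_trees_iff comp_unit fl_unit
        intro!: bexI[of _ "unit (lvs t)"] simp del: atLeastAtMost_iff)
  then obtain c where "pointed_step R (t, i) c" "pointed_step R (t', i') c"
    using equivclp_joinable[OF assms(1)[unfolded X_class_eq_iff]]
      pointed_step_trans pointed_step_diamond by blast
  then have "\<exists>f\<in>Mor. \<exists>f'\<in>Mor. lvs t = rts f \<and> lvs t' = rts f' \<and> t \<cdot> f = t' \<cdot> f' \<and> fl f i = fl f' i'"
    unfolding pointed_step_iff by blast
  with that show thesis by blast
qed

text \<open>Some common refinement of \<open>(t, i)\<close> and \<open>(t', i')\<close> has equal positions.  Refining it and the given
  one to a common third, left cancellation identifies the refining forests over \<open>t'\<close> too, and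
  \<open>fl b\<close> is injective, so the positions agree in the given refinement as well.\<close>

lemma X_class_eq_fl:
  assumes eq: "X_class R t i = X_class R t' i'"
    and ti: "(t, i) \<in> pointed_trees R" "(t', i') \<in> pointed_trees R"
    and p: "p \<in> Mor" "lvs t = rts p" and q: "q \<in> Mor" "lvs t' = rts q" and pq: "t \<cdot> p = t' \<cdot> q"
  shows "fl p i = fl q i'"
proof -
  have t: "t \<in> Mor" "t' \<in> Mor" "rts t = rts t'" "i \<in> {1..lvs t}" "i' \<in> {1..lvs t'}"
    using ti by (auto simp: pointed_trees_iff)
  obtain f f' where f: "f \<in> Mor" "lvs t = rts f" and f': "f' \<in> Mor" "lvs t' = rts f'"
    and ff: "t \<cdot> f = t' \<cdot> f'" "fl f i = fl f' i'"
    using X_class_joinable[OF eq ti(1)] by metis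
  obtain a b where a: "a \<in> Mor" "lvs f = rts a" and b: "b \<in> Mor" "lvs p = rts b"
    and ab: "f \<cdot> a = p \<cdot> b"
    using common_refinement[OF f(1) p(1)] f p by metis
  have lvs: "lvs f' = rts a" "lvs q = rts b"
    using lvs_comp[OF t(1) f] lvs_comp[OF t(2) f'] lvs_comp[OF t(1) p] lvs_comp[OF t(2) q] ff pq a b
    by simp_all
  have "t' \<cdot> (f' \<cdot> a) = t' \<cdot> (q \<cdot> b)"
    using comp_assoc[OF t(2) f'(1) a(1) f'(2) lvs(1)] comp_assoc[OF t(2) q(1) b(1) q(2) lvs(2)]
      comp_assoc[OF t(1) f(1) a(1) f(2) a(2)] comp_assoc[OF t(1) p(1) b(1) p(2) b(2)] ff pq ab
    by simp
  then have ab': "f' \<cdot> a = q \<cdot> b"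
    using comp_left_cancel[OF t(2) comp_Mor[OF f'(1) a(1) lvs(1)] comp_Mor[OF q(1) b(1) lvs(2)]]
      rts_comp[OF f'(1) a(1) lvs(1)] rts_comp[OF q(1) b(1) lvs(2)] f'(2) q(2) by simp
  have "fl b (fl p i) = fl (f \<cdot> a) i"
    using ab p b by (simp add: fl_comp)
  also have "\<dots> = fl a (fl f' i')"
    using f a ff(2) by (simp add: fl_comp)
  also have "\<dots> = fl (q \<cdot> b) i'"
    using fl_comp[OF f'(1) a(1) lvs(1), of i'] ab' by simp
  also have "\<dots> = fl b (fl q i')"
    using q b lvs by (simp add: fl_comp)
  finally have "fl b (fl p i) = fl b (fl q i')" .
  moreover have "fl p i \<in> {1..rts b}" "fl q i' \<in> {1..rts b}"
    using fl_range[OF p(1)] fl_range[OF q(1)] t p q b lvs by metis+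
  ultimately show ?thesis
    using fl_eq_iff[OF b(1)] by blast
qed

lemma X_class_refine:
  assumes "(t, i) \<in> pointed_trees R" "f \<in> Mor" "lvs t = rts f"
  shows "X_class R (t \<cdot> f) (fl f i) = X_class R t i"
proof -
  have "pointed_step R (t, i) (t \<cdot> f, fl f i)"
    using assms by (auto simp: pointed_step_iff)
  then show ?thesis
    unfolding X_class_eq_iff by (rule equivclp_sym[OF r_into_equivclp])
qed

text \<open>The representatives that witness the order may live over other trees; refined together with \<open>t\<close> they
  can be compared there, as \<open>fl\<close> is strictly increasing.\<close>

lemma X_le_iff:
  assumes i: "(t, i) \<in> pointed_trees R" and j: "(t, j) \<in> pointed_trees R"
  shows "X_le R (X_class R t i) (X_class R t j) \<longleftrightarrow> i \<le> j"
proof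
  have t: "t \<in> Mor" "rts t = 1" "i \<in> {1..lvs t}" "j \<in> {1..lvs t}"
    using i j by (auto simp: pointed_trees_iff)
  {
    assume "i \<le> j"
    then have "fl (unit (lvs t)) i \<le> fl (unit (lvs t)) j"
      by (simp only: fl_unit t)
    then show "X_le R (X_class R t i) (X_class R t j)"
      unfolding X_le_def using i j unit_Mor by metis
  next
    assume "X_le R (X_class R t i) (X_class R t j)"
    then obtain t1 i' t2 j' f1 f2 where
      1: "(t1, i') \<in> pointed_trees R" "X_class R t i = X_class R t1 i'" "f1 \<in> Mor" "lvs t1 = rts f1" and
      2: "(t2, j') \<in> pointed_trees R" "X_class R t j = X_class R t2 j'" "f2 \<in> Mor" "lvs t2 = rts f2" and
      eq: "t1 \<cdot> f1 = t2 \<cdot> f2" and le: "fl f1 i' \<le> fl f2 j'"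
      unfolding X_le_def by blast
    have T: "t1 \<in> Mor" "rts t1 = 1" "i' \<in> {1..lvs t1}" "t2 \<in> Mor" "rts t2 = 1" "j' \<in> {1..lvs t2}"
      using 1(1) 2(1) by (auto simp: pointed_trees_iff)
    obtain u v where u: "u \<in> Mor" "lvs (t1 \<cdot> f1) = rts u" and v: "v \<in> Mor" "lvs t = rts v"
      and uv: "t1 \<cdot> f1 \<cdot> u = t \<cdot> v"
      using common_refinement[of "t1 \<cdot> f1" t] T t comp_closed[OF T(1) 1(3,4)] by metis
    have lvs: "lvs f1 = rts u" "lvs f2 = rts u"
      using u(2) eq lvs_comp[OF T(1) 1(3,4)] lvs_comp[OF T(4) 2(3,4)] by simp_all
    have "fl v i = fl (f1 \<cdot> u) i'"
      using 1 u v uv T lvs i comp_closed[OF 1(3) u(1) lvs(1)]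
      by (intro X_class_eq_fl[OF 1(2)]) (simp_all add: comp_assoc)
    moreover have "fl v j = fl (f2 \<cdot> u) j'"
      using 2 u v uv T lvs j eq comp_closed[OF 2(3) u(1) lvs(2)]
      by (intro X_class_eq_fl[OF 2(2)]) (simp_all add: comp_assoc[symmetric])
    moreover have "fl u (fl f1 i') \<le> fl u (fl f2 j')"
      using le fl_le_iff[OF u(1)] fl_range[OF 1(3)] fl_range[OF 2(3)] T 1(4) 2(4) lvs by metis
    ultimately have "fl v i \<le> fl v j"
      using 1 2 u lvs by (simp add: fl_comp)
    then show "i \<le> j"
      using fl_le_iff[OF v(1)] t v(2) by metis
  }
qed

text \<open>A point over \<open>t f\<close> is also a point over every further refinement, so the tree can be refined for one
  point after the other.\<close>

lemma finite_common_tree: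
  assumes "finite Y" "Y \<subseteq> X_set R" "t \<in> skein_trees R"
  obtains f where "f \<in> Mor" "lvs t = rts f"
    "\<And>y. y \<in> Y \<Longrightarrow> \<exists>a\<in>{1..lvs f}. y = X_class R (t \<cdot> f) a"
proof -
  have t: "t \<in> Mor" "rts t = 1" using assms(3) by (auto simp: skein_trees_iff)
  have "\<exists>f. f \<in> Mor \<and> lvs t = rts f \<and> (\<forall>y\<in>Y. \<exists>a\<in>{1..lvs f}. y = X_class R (t \<cdot> f) a)"
    using assms(1,2)
  proof (induction rule: finite_induct)
    case empty
    show ?case by (intro exI[of _ "unit (lvs t)"]) simp
  next
    case (insert y Y)
    then obtain f where f: "f \<in> Mor" "lvs t = rts f"
      "\<forall>y\<in>Y. \<exists>a\<in>{1..lvs f}. y = X_class R (t \<cdot> f) a" by blast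
    obtain u j where u: "y = X_class R u j" "(u, j) \<in> pointed_trees R"
      using insert.prems by (auto simp: X_set_def)
    then have u': "u \<in> Mor" "rts u = 1" "j \<in> {1..lvs u}" by (auto simp: pointed_trees_iff)
    note tf = comp_closed[OF t(1) f(1,2)]
    obtain p q where p: "p \<in> Mor" "lvs (t \<cdot> f) = rts p" and q: "q \<in> Mor" "lvs u = rts q"
      and pq: "t \<cdot> f \<cdot> p = u \<cdot> q"
      using common_refinement[of "t \<cdot> f" u] tf u' t by metis
    have fp: "lvs f = rts p" using p tf by simp
    note fp' = comp_closed[OF f(1) p(1) fp]
    have assoc: "t \<cdot> f \<cdot> p = t \<cdot> (f \<cdot> p)" using t f p fp by (simp add: comp_assoc)
    have lq: "lvs q = lvs p"
      using pq lvs_comp[OF u'(1) q] lvs_comp[OF tf(1) p] by simp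
    have "\<exists>a\<in>{1..lvs p}. y' = X_class R (t \<cdot> (f \<cdot> p)) a" if "y' \<in> Y" for y'
    proof -
      obtain a where a: "a \<in> {1..lvs f}" "y' = X_class R (t \<cdot> f) a" using f(3) \<open>y' \<in> Y\<close> by blast
      have "(t \<cdot> f, a) \<in> pointed_trees R"
        using a tf t by (simp add: pointed_trees_iff)
      then show ?thesis
        using X_class_refine[of "t \<cdot> f" a p] p a fl_range[OF p(1), of a] fp assoc by metis
    qed
    moreover have "\<exists>a\<in>{1..lvs p}. y = X_class R (t \<cdot> (f \<cdot> p)) a"
      using X_class_refine[OF u(2) q] u(1) fl_range[OF q(1), of j] u'(3) q lq pq assoc by metis
    ultimately show ?case
      using fp' f by (intro exI[of _ "f \<cdot> p"]) auto
  qed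
  with that show thesis by blast
qed

section \<open>The V-group and its action\<close>

lemma tree_pairs_iff:
  "(s, \<pi>, t) \<in> tree_pairs R \<longleftrightarrow> s \<in> Mor \<and> rts s = 1 \<and> t \<in> Mor \<and> rts t = 1 \<and> lvs s = lvs t
    \<and> \<pi> permutes {1..lvs t}"
  by (auto simp: tree_pairs_def skein_trees_iff)

lemma tree_pair_fraction:
  "(s, \<pi>, t) \<in> tree_pairs R \<Longrightarrow> ((s, \<pi>), (t, id)) \<in> fractions (ForCV R) 1"
  by (auto simp: tree_pairs_iff permutes_id intro!: fractionsI)

text \<open>The denominator \<open>t \<circ> \<tau>\<close> loses its permutation if the fraction is multiplied by
  \<open>\<tau>\<^sup>-\<^sup>1\<close>.\<close>

lemma carrier_V_group:
  assumes "g \<in> carrier (V_group R)"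
  obtains s \<pi> t where "(s, \<pi>, t) \<in> tree_pairs R" "g = V_elem R s \<pi> t"
proof -
  obtain s \<sigma> t \<tau> where st: "((s, \<sigma>), (t, \<tau>)) \<in> fractions (ForCV R) 1"
    and g: "g = fraction_class (ForCV R) 1 ((s, \<sigma>), (t, \<tau>))"
    using assms by (auto simp: V_group_def Frac_def)
  have m: "s \<in> Mor" "t \<in> Mor" "rts s = 1" "rts t = 1" "lvs s = lvs t"
    and \<sigma>s: "\<sigma> permutes {1..lvs s}" and \<tau>: "\<tau> permutes {1..lvs t}"
    using st unfolding fractions_def mem_Collect_eq case_prod_conv MorV_iff rootsV leavesV by blast+
  have \<sigma>: "\<sigma> permutes {1..lvs t}" using \<sigma>s unfolding m(5) .
  let ?\<tau>' = "inv_into UNIV \<tau>"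
  let ?H = "(unit (lvs t), ?\<tau>')"
  have \<tau>': "?\<tau>' permutes {1..lvs t}" using permutes_inv[OF \<tau>] .
  have "s \<cdot> unit (lvs t) = s" "t \<cdot> unit (lvs t) = t"
    using comp_unit[OF m(1)] comp_unit[OF m(2)] m(5) by (simp_all only:)
  then have "(s, \<sigma>) \<bullet> ?H = (s, \<sigma> \<circ> ?\<tau>')" "(t, \<tau>) \<bullet> ?H = (t, id)"
    by (simp_all only: compV pt_unit[OF \<sigma>] pl_unit[OF \<sigma>] pt_unit[OF \<tau>] pl_unit[OF \<tau>]
        permutes_inv_o(1)[OF \<tau>])
  then have "fraction_step (ForCV R) 1 ((s, \<sigma>), (t, \<tau>)) ((s, \<sigma> \<circ> ?\<tau>'), (t, id))"
    unfolding fraction_step_iff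
    using st m \<tau>' by (intro conjI bexI[of _ ?H]) (simp_all del: compV)
  then have "g = V_elem R s (\<sigma> \<circ> ?\<tau>') t"
    unfolding g V_elem_def fraction_class_def
    by (simp only: equivclp_class_eq_iff r_into_equivclp)
  moreover have "(s, \<sigma> \<circ> ?\<tau>', t) \<in> tree_pairs R"
    using m \<sigma> \<tau>' by (simp add: tree_pairs_iff permutes_compose)
  ultimately show thesis using that by blast
qed

lemma V_elem_refine:
  assumes st: "(s, \<pi>, t) \<in> tree_pairs R" and f: "f \<in> Mor" "lvs t = rts f"
  shows "(s \<cdot> pt \<pi> f, pl \<pi> f, t \<cdot> f) \<in> tree_pairs R"
    and "V_elem R (s \<cdot> pt \<pi> f) (pl \<pi> f) (t \<cdot> f) = V_elem R s \<pi> t"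
proof -
  have m: "s \<in> Mor" "rts s = 1" "t \<in> Mor" "rts t = 1" "lvs s = lvs t" and \<pi>: "\<pi> permutes {1..rts f}"
    using st f by (auto simp: tree_pairs_iff)
  show "(s \<cdot> pt \<pi> f, pl \<pi> f, t \<cdot> f) \<in> tree_pairs R"
    using m f pt_closed[OF f(1) \<pi>] comp_closed[OF m(3) f] comp_closed[of s "pt \<pi> f"]
    by (simp add: tree_pairs_iff)
  have "(s, \<pi>) \<bullet> (f, id) = (s \<cdot> pt \<pi> f, pl \<pi> f)" "(t, id) \<bullet> (f, id) = (t \<cdot> f, id)"
    using pt_id[OF f(1)] pl_id[OF f(1)] by simp_all
  then have "fraction_step (ForCV R) 1 ((s, \<pi>), (t, id)) ((s \<cdot> pt \<pi> f, pl \<pi> f), (t \<cdot> f, id))"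
    unfolding fraction_step_iff
    using tree_pair_fraction[OF st] f m by (intro conjI bexI[of _ "(f, id)"]) (simp_all del: compV add: permutes_id)
  then show "V_elem R (s \<cdot> pt \<pi> f) (pl \<pi> f) (t \<cdot> f) = V_elem R s \<pi> t"
    unfolding V_elem_eq_iff by (rule equivclp_sym[OF r_into_equivclp])
qed

lemma V_elem_joinable:
  assumes eq: "V_elem R s \<pi> t = V_elem R s' \<pi>' t'"
    and st: "(s, \<pi>, t) \<in> tree_pairs R"
  obtains f f' where "f \<in> Mor" "f' \<in> Mor" "lvs t = rts f" "lvs t' = rts f'"
    "t \<cdot> f = t' \<cdot> f'" "s \<cdot> pt \<pi> f = s' \<cdot> pt \<pi>' f'" "pl \<pi> f = pl \<pi>' f'"
proof -
  let ?x = "((s, \<pi>), (t, id))" and ?x' = "((s', \<pi>'), (t', id))"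
  have m: "s \<in> Mor" "t \<in> Mor" "\<pi> permutes {1..lvs s}" "lvs s = lvs t"
    using st by (auto simp: tree_pairs_iff)
  have "fraction_step (ForCV R) 1 ?x ?x"
    unfolding fraction_step_iff
    using tree_pair_fraction[OF st] m compV_unit[of "(s, \<pi>)"] compV_unit[of "(t, id)"]
    by (intro conjI bexI[of _ "(unit (lvs t), id)"]) (simp_all del: compV add: permutes_id)
  then obtain c where c: "fraction_step (ForCV R) 1 ?x c" "fraction_step (ForCV R) 1 ?x' c"
    using equivclp_joinable[OF eq[unfolded V_elem_eq_iff]] fraction_step_trans fraction_step_diamond
    by blast
  obtain f \<rho> where f: "(f, \<rho>) \<in> MorV" "lvs t = rts f" "c = ((s, \<pi>) \<bullet> (f, \<rho>), (t, id) \<bullet> (f, \<rho>))"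
    using c(1) m by (auto simp: fraction_step_iff simp del: compV)
  obtain f' \<rho>' where f': "(f', \<rho>') \<in> MorV" "lvs t' = rts f'"
    "c = ((s', \<pi>') \<bullet> (f', \<rho>'), (t', id) \<bullet> (f', \<rho>'))"
    using c(2) by (auto simp: fraction_step_iff fractions_def simp del: compV)
  have ff: "f \<in> Mor" "f' \<in> Mor" and \<rho>: "\<rho> permutes {1..lvs f}" using f(1) f'(1) by auto
  have eqs: "t \<cdot> f = t' \<cdot> f'" "s \<cdot> pt \<pi> f = s' \<cdot> pt \<pi>' f'" "\<rho> = \<rho>'" "pl \<pi> f \<circ> \<rho> = pl \<pi>' f' \<circ> \<rho>'"
    using f(3) f'(3) pt_id[OF ff(1)] pl_id[OF ff(1)] pt_id[OF ff(2)] pl_id[OF ff(2)] by auto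
  then have "pl \<pi> f \<circ> (\<rho> \<circ> inv_into UNIV \<rho>) = pl \<pi>' f' \<circ> (\<rho> \<circ> inv_into UNIV \<rho>)"
    by (simp only: o_assoc)
  then have "pl \<pi> f = pl \<pi>' f'"
    by (simp add: permutes_inv_o(1)[OF \<rho>])
  with that ff f(2) f'(2) eqs show thesis by blast
qed

text \<open>Two descriptions of the same element and the same point coincide over a common refinement
  \<open>t f = t' f'\<close>, and there \<open>[s, \<pi> j]\<close> is \<open>[s f\<^sup>\<pi>, \<pi>\<^sup>f (j\<^sup>f)]\<close>, which depends on the refined
  data only.\<close>

lemma X_act_V_elem:
  assumes st: "(s, \<pi>, t) \<in> tree_pairs R" and j: "j \<in> {1..lvs t}"
  shows "X_act R (V_elem R s \<pi> t) (X_class R t j) = X_class R s (\<pi> j)"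
proof -
  have image: "X_class R s (\<pi> j) = X_class R (s \<cdot> pt \<pi> f) (pl \<pi> f (fl f j))"
    if "(s, \<pi>, t) \<in> tree_pairs R" "j \<in> {1..lvs t}" "f \<in> Mor" "lvs t = rts f" for s \<pi> t j f
  proof -
    have m: "s \<in> Mor" "rts s = 1" "lvs s = rts f" "\<pi> permutes {1..rts f}" "j \<in> {1..rts f}"
      using that by (auto simp: tree_pairs_iff)
    then have "\<pi> j \<in> {1..rts f}" using permutes_in_image by metis
    then have "(s, \<pi> j) \<in> pointed_trees R"
      using m by (simp add: pointed_trees_iff)
    then show ?thesis
      using X_class_refine[of s "\<pi> j" "pt \<pi> f"] pl_fl[OF that(3) m(4,5)] pt_closed[OF that(3) m(4)] m
      by simp
  qed
  have pointed: "(t, j) \<in> pointed_trees R"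
    using st j by (auto simp: tree_pairs_iff pointed_trees_iff)
  have "X_class R s' (\<pi>' j') = X_class R s (\<pi> j)"
    if "(s', \<pi>', t') \<in> tree_pairs R" "(t', j') \<in> pointed_trees R"
      and elem: "V_elem R s \<pi> t = V_elem R s' \<pi>' t'"
      and point: "X_class R t j = X_class R t' j'" for s' \<pi>' t' j'
  proof -
    obtain f f' where f: "f \<in> Mor" "f' \<in> Mor" "lvs t = rts f" "lvs t' = rts f'"
      "t \<cdot> f = t' \<cdot> f'" "s \<cdot> pt \<pi> f = s' \<cdot> pt \<pi>' f'" "pl \<pi> f = pl \<pi>' f'"
      using V_elem_joinable[OF elem st] by metis
    have "fl f j = fl f' j'"
      using X_class_eq_fl[OF point pointed that(2) f(1,3) f(2,4,5)] .
    moreover have "j' \<in> {1..lvs t'}" using that(2) by (simp add: pointed_trees_iff)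
    ultimately show ?thesis
      using image[OF st j f(1,3)] image[OF that(1) _ f(2,4), of j'] f by simp
  qed
  then have "{X_class R s' (\<pi>' j') | s' \<pi>' t' j'.
     (s', \<pi>', t') \<in> tree_pairs R \<and> (t', j') \<in> pointed_trees R \<and>
     V_elem R s \<pi> t = V_elem R s' \<pi>' t' \<and> X_class R t j = X_class R t' j'} = {X_class R s (\<pi> j)}"
    using st pointed by blast
  then show ?thesis by (simp add: X_act_def)
qed


text \<open>Over a common tree, points are numbers and the element is a permutation of them; this turns the
  two properties to be shown into properties of \<open>\<pi>\<^sup>f\<close>.\<close>

lemma V_elem_common_tree:
  assumes st: "(s, \<pi>, t) \<in> tree_pairs R" and Y: "finite Y" "Y \<subseteq> X_set R"
  obtains f s' t' where "f \<in> Mor" "lvs t = rts f" "lvs t' = lvs f"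
    "(s', pl \<pi> f, t') \<in> tree_pairs R" "V_elem R s \<pi> t = V_elem R s' (pl \<pi> f) t'"
    "\<forall>y\<in>Y. \<exists>a\<in>{1..lvs t'}. y = X_class R t' a"
proof -
  have t: "t \<in> skein_trees R" "t \<in> Mor" using st by (auto simp: tree_pairs_iff skein_trees_iff)
  obtain f where f: "f \<in> Mor" "lvs t = rts f"
    "\<And>y. y \<in> Y \<Longrightarrow> \<exists>a\<in>{1..lvs f}. y = X_class R (t \<cdot> f) a"
    using finite_common_tree[OF Y t(1)] by blast
  show thesis
    using that[of f "t \<cdot> f" "s \<cdot> pt \<pi> f"] f V_elem_refine[OF st f(1,2)] lvs_comp[OF t(2) f(1,2)]
    by simp
qed

lemma X_le_tree_pair:
  assumes st: "(s, \<pi>, t) \<in> tree_pairs R" and ij: "i \<in> {1..lvs t}" "j \<in> {1..lvs t}"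
  shows "X_le R (X_class R t i) (X_class R t j) \<longleftrightarrow> i \<le> j"
    and "X_le R (X_act R (V_elem R s \<pi> t) (X_class R t i)) (X_act R (V_elem R s \<pi> t) (X_class R t j))
      \<longleftrightarrow> \<pi> i \<le> \<pi> j"
proof -
  have m: "t \<in> Mor" "rts t = 1" "s \<in> Mor" "rts s = 1" "lvs s = lvs t" "\<pi> permutes {1..lvs t}"
    using st by (simp_all add: tree_pairs_iff)
  show "X_le R (X_class R t i) (X_class R t j) \<longleftrightarrow> i \<le> j"
    using m ij by (intro X_le_iff) (simp_all only: pointed_trees_iff)
  have "\<pi> i \<in> {1..lvs s}" "\<pi> j \<in> {1..lvs s}"
    using ij permutes_in_image[OF m(6)] unfolding m(5) by blast+
  then show "X_le R (X_act R (V_elem R s \<pi> t) (X_class R t i)) (X_act R (V_elem R s \<pi> t) (X_class R t j))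
      \<longleftrightarrow> \<pi> i \<le> \<pi> j"
    unfolding X_act_V_elem[OF st ij(1)] X_act_V_elem[OF st ij(2)]
    using m by (intro X_le_iff) (simp_all only: pointed_trees_iff)
qed

lemma X_class_X_set: "(s, \<pi>, t) \<in> tree_pairs R \<Longrightarrow> i \<in> {1..lvs t} \<Longrightarrow> X_class R t i \<in> X_set R"
proof -
  assume "(s, \<pi>, t) \<in> tree_pairs R" "i \<in> {1..lvs t}"
  then have "(t, i) \<in> pointed_trees R"
    by (simp only: tree_pairs_iff pointed_trees_iff)
  then show ?thesis unfolding X_set_def by blast
qed

section \<open>Elements that preserve the order or the cyclic order\<close>

lemma F_group_monotone:
  assumes "g \<in> F_group R" and xy: "x \<in> X_set R" "y \<in> X_set R" "X_le R x y"
  shows "X_le R (X_act R g x) (X_act R g y)"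
proof -
  obtain s t where st: "(s, id, t) \<in> tree_pairs R" and g: "g = V_elem R s id t"
    using assms(1) by (auto simp: F_group_def)
  have Y: "finite {x, y}" "{x, y} \<subseteq> X_set R" using xy by simp_all
  obtain f s' t' where f: "f \<in> Mor" "lvs t = rts f" "lvs t' = lvs f"
    and s't': "(s', pl id f, t') \<in> tree_pairs R" and g': "V_elem R s id t = V_elem R s' (pl id f) t'"
    and points: "\<forall>z\<in>{x, y}. \<exists>a\<in>{1..lvs t'}. z = X_class R t' a"
    by (rule V_elem_common_tree[OF st Y]) blast
  obtain a b where a: "a \<in> {1..lvs t'}" "x = X_class R t' a" and b: "b \<in> {1..lvs t'}" "y = X_class R t' b"
    using points by auto
  have "a \<le> b"
    using X_le_tree_pair(1)[OF s't' a(1) b(1)] xy(3) a(2) b(2) by simp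
  then show ?thesis
    using X_le_tree_pair(2)[OF s't' a(1) b(1)] pl_id[OF f(1)]
    unfolding g g' a(2) b(2) by simp
qed

lemma monotone_in_F_group:
  assumes "g \<in> carrier (V_group R)"
    and mono: "\<And>x y. x \<in> X_set R \<Longrightarrow> y \<in> X_set R \<Longrightarrow> X_le R x y \<Longrightarrow> X_le R (X_act R g x) (X_act R g y)"
  shows "g \<in> F_group R"
proof -
  obtain s \<pi> t where st: "(s, \<pi>, t) \<in> tree_pairs R" and g: "g = V_elem R s \<pi> t"
    using assms(1) by (rule carrier_V_group)
  have "\<pi> i \<le> \<pi> (i + 1)" if "i \<in> {1..<lvs t}" for i
  proof -
    have i: "i \<in> {1..lvs t}" "i + 1 \<in> {1..lvs t}" using that by auto
    then show ?thesis
      using mono[OF X_class_X_set[OF st i(1)] X_class_X_set[OF st i(2)]] X_le_tree_pair[OF st i]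
      unfolding g by simp
  qed
  then have "\<pi> = id"
    using st by (intro monotone_permutation_id[of \<pi> "lvs t"]) (simp_all add: tree_pairs_iff)
  with st g assms(1) show ?thesis by (auto simp: F_group_def)
qed

text \<open>Over a common tree the chain is an increasing sequence of positions, and the element permutes the
  positions cyclically.\<close>

lemma T_group_cyclic_on_chains:
  assumes "g \<in> T_group R" and x: "\<And>i. i \<in> {1..k} \<Longrightarrow> x i \<in> X_set R"
    and chain: "\<And>i. i \<in> {1..<k} \<Longrightarrow> X_le R (x i) (x (i + 1))"
  shows "\<exists>\<rho>\<in>cyclic_perms k. \<forall>i\<in>{1..<k}. X_le R (X_act R g (x (\<rho> i))) (X_act R g (x (\<rho> (i + 1))))"
proof -
  obtain s \<pi> t where st: "(s, \<pi>, t) \<in> tree_pairs R" and \<pi>: "\<pi> \<in> cyclic_perms (lvs t)"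
    and g: "g = V_elem R s \<pi> t"
    using assms(1) by (auto simp: T_group_def)
  have Y: "finite (x ` {1..k})" "x ` {1..k} \<subseteq> X_set R" using x by auto
  obtain f s' t' where f: "f \<in> Mor" "lvs t = rts f" "lvs t' = lvs f"
    and s't': "(s', pl \<pi> f, t') \<in> tree_pairs R" and g': "V_elem R s \<pi> t = V_elem R s' (pl \<pi> f) t'"
    and points: "\<forall>y\<in>x ` {1..k}. \<exists>a\<in>{1..lvs t'}. y = X_class R t' a"
    by (rule V_elem_common_tree[OF st Y]) blast
  have "\<forall>i\<in>{1..k}. \<exists>b. b \<in> {1..lvs t'} \<and> x i = X_class R t' b"
    using points by blast
  from bchoice[OF this] obtain a where
    "\<forall>i\<in>{1..k}. a i \<in> {1..lvs t'} \<and> x i = X_class R t' (a i)" by blast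
  then have a: "\<And>i. i \<in> {1..k} \<Longrightarrow> a i \<in> {1..lvs t'} \<and> x i = X_class R t' (a i)"
    by blast
  have "pl \<pi> f \<in> cyclic_perms (lvs t')"
    using pl_cyclic[OF f(1)] \<pi> f(2,3) by simp
  moreover have "a i \<le> a (i + 1)" if "i \<in> {1..<k}" for i
  proof -
    have i: "i \<in> {1..k}" "i + 1 \<in> {1..k}" using that by auto
    show ?thesis
      using chain[OF that] X_le_tree_pair(1)[OF s't'] a[OF i(1)] a[OF i(2)] by metis
  qed
  ultimately obtain \<rho> where \<rho>: "\<rho> \<in> cyclic_perms k"
    "\<And>i. i \<in> {1..<k} \<Longrightarrow> pl \<pi> f (a (\<rho> i)) \<le> pl \<pi> f (a (\<rho> (i + 1)))"
    using cyclic_perm_rotates_chain[of "pl \<pi> f" "lvs t'" k a] a by blast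
  have "X_le R (X_act R g (x (\<rho> i))) (X_act R g (x (\<rho> (i + 1))))" if "i \<in> {1..<k}" for i
  proof -
    have "i \<in> {1..k}" "i + 1 \<in> {1..k}" using that by auto
    then have "\<rho> i \<in> {1..k}" "\<rho> (i + 1) \<in> {1..k}"
      using permutes_in_image[OF cyclic_perms_permutes[OF \<rho>(1)]] by blast+
    note a' = this[THEN a]
    show ?thesis
      using X_le_tree_pair(2)[OF s't', of "a (\<rho> i)" "a (\<rho> (i + 1))"] a' \<rho>(2)[OF that]
      unfolding g g' by metis
  qed
  with \<rho>(1) show ?thesis by blast
qed

text \<open>On the chain of all leaves of \<open>t\<close>, the rearrangement \<open>\<rho>\<close> makes \<open>\<pi> \<circ> \<rho>\<close> increasing, hence the
  identity, and so \<open>\<pi>\<close> is the inverse of a cyclic permutation.\<close>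

lemma cyclic_on_chains_in_T_group:
  assumes "g \<in> carrier (V_group R)"
    and cyclic: "\<And>k x. k \<ge> 1 \<Longrightarrow> (\<And>i. i \<in> {1..k} \<Longrightarrow> x i \<in> X_set R) \<Longrightarrow>
      (\<And>i. i \<in> {1..<k} \<Longrightarrow> X_le R (x i) (x (i + 1))) \<Longrightarrow>
      \<exists>\<rho>\<in>cyclic_perms k. \<forall>i\<in>{1..<k}. X_le R (X_act R g (x (\<rho> i))) (X_act R g (x (\<rho> (i + 1))))"
  shows "g \<in> T_group R"
proof -
  obtain s \<pi> t where st: "(s, \<pi>, t) \<in> tree_pairs R" and g: "g = V_elem R s \<pi> t"
    using assms(1) by (rule carrier_V_group)
  let ?n = "lvs t"
  have t: "t \<in> Mor" "rts t = 1" and \<pi>: "\<pi> permutes {1..?n}"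
    using st by (simp_all add: tree_pairs_iff)
  have "?n \<ge> 1"
    using fl_range[OF t(1), of 1] t(2) by simp
  moreover have "X_le R (X_class R t i) (X_class R t (i + 1))" if "i \<in> {1..<?n}" for i
  proof -
    have "i \<in> {1..?n}" "i + 1 \<in> {1..?n}" using that by auto
    with X_le_tree_pair(1)[OF st] show ?thesis by simp
  qed
  ultimately obtain \<rho> where \<rho>: "\<rho> \<in> cyclic_perms ?n"
    and mono: "\<And>i. i \<in> {1..<?n} \<Longrightarrow>
      X_le R (X_act R g (X_class R t (\<rho> i))) (X_act R g (X_class R t (\<rho> (i + 1))))"
    using cyclic[of ?n "X_class R t"] X_class_X_set[OF st] by blast
  note \<rho>_perm = cyclic_perms_permutes[OF \<rho>]
  have "(\<pi> \<circ> \<rho>) i \<le> (\<pi> \<circ> \<rho>) (i + 1)" if "i \<in> {1..<?n}" for i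
  proof -
    have "i \<in> {1..?n}" "i + 1 \<in> {1..?n}" using that by auto
    then have "\<rho> i \<in> {1..?n}" "\<rho> (i + 1) \<in> {1..?n}"
      using permutes_in_image[OF \<rho>_perm] by blast+
    then show ?thesis
      using mono[OF that] X_le_tree_pair(2)[OF st] unfolding g by simp
  qed
  then have \<pi>\<rho>: "\<pi> \<circ> \<rho> = id"
    using permutes_compose[OF \<rho>_perm \<pi>] by (intro monotone_permutation_id)
  obtain \<rho>' where \<rho>': "\<rho>' \<in> cyclic_perms ?n" "\<rho> \<circ> \<rho>' = id"
    using \<rho> by (rule cyclic_perms_inverse)
  have "\<pi> = \<pi> \<circ> (\<rho> \<circ> \<rho>')" by (simp add: \<rho>'(2))
  also have "\<dots> = \<rho>'" by (simp add: o_assoc \<pi>\<rho>)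
  finally have "\<pi> \<in> cyclic_perms ?n" using \<rho>'(1) by simp
  with st g assms(1) show ?thesis by (auto simp: T_group_def)
qed

end

theorem proposition6p1:
  fixes R :: "('s tree \<times> 's tree) set"
  assumes same_leaves: "\<forall>(t, u) \<in> R. size1 t = size1 u"
    and ore: "ore_category (ForC R)"
  shows "F_group R =
      {g \<in> carrier (V_group R).
         \<forall>x\<in>X_set R. \<forall>y\<in>X_set R. X_le R x y \<longrightarrow> X_le R (X_act R g x) (X_act R g y)}
    \<and> T_group R =
      {g \<in> carrier (V_group R).
         \<forall>k\<ge>1. \<forall>x. (\<forall>i\<in>{1..k}. x i \<in> X_set R) \<and> (\<forall>i\<in>{1..<k}. X_le R (x i) (x (i + 1))) \<longrightarrow>
           (\<exists>\<pi>\<in>cyclic_perms k.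
              \<forall>i\<in>{1..<k}. X_le R (X_act R g (x (\<pi> i))) (X_act R g (x (\<pi> (i + 1)))))}"
proof -
  interpret ore_skein_presentation R
    by unfold_locales (rule same_leaves, rule ore)
  have carrier: "F_group R \<subseteq> carrier (V_group R)" "T_group R \<subseteq> carrier (V_group R)"
    by (auto simp: F_group_def T_group_def)
  show ?thesis
  proof (intro conjI equalityI subsetI CollectI)
    fix g assume g: "g \<in> F_group R"
    show "g \<in> carrier (V_group R)" using g carrier by blast
    show "\<forall>x\<in>X_set R. \<forall>y\<in>X_set R. X_le R x y \<longrightarrow> X_le R (X_act R g x) (X_act R g y)"
      using F_group_monotone[OF g] by blast
  next
    fix g assume "g \<in> {g \<in> carrier (V_group R).
         \<forall>x\<in>X_set R. \<forall>y\<in>X_set R. X_le R x y \<longrightarrow> X_le R (X_act R g x) (X_act R g y)}"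
    then show "g \<in> F_group R" using monotone_in_F_group by blast
  next
    fix g assume g: "g \<in> T_group R"
    show "g \<in> carrier (V_group R)" using g carrier by blast
    show "\<forall>k\<ge>1. \<forall>x. (\<forall>i\<in>{1..k}. x i \<in> X_set R) \<and> (\<forall>i\<in>{1..<k}. X_le R (x i) (x (i + 1))) \<longrightarrow>
           (\<exists>\<pi>\<in>cyclic_perms k.
              \<forall>i\<in>{1..<k}. X_le R (X_act R g (x (\<pi> i))) (X_act R g (x (\<pi> (i + 1)))))"
    proof (intro allI impI)
      fix k :: nat and x assume "1 \<le> k"
        and x: "(\<forall>i\<in>{1..k}. x i \<in> X_set R) \<and> (\<forall>i\<in>{1..<k}. X_le R (x i) (x (i + 1)))"
      show "\<exists>\<pi>\<in>cyclic_perms k. \<forall>i\<in>{1..<k}. X_le R (X_act R g (x (\<pi> i))) (X_act R g (x (\<pi> (i + 1))))"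
        by (rule T_group_cyclic_on_chains[OF g]) (use x in blast)+
    qed
  next
    fix g assume g: "g \<in> {g \<in> carrier (V_group R).
         \<forall>k\<ge>1. \<forall>x. (\<forall>i\<in>{1..k}. x i \<in> X_set R) \<and> (\<forall>i\<in>{1..<k}. X_le R (x i) (x (i + 1))) \<longrightarrow>
           (\<exists>\<pi>\<in>cyclic_perms k.
              \<forall>i\<in>{1..<k}. X_le R (X_act R g (x (\<pi> i))) (X_act R g (x (\<pi> (i + 1)))))}"
    show "g \<in> T_group R"
    proof (rule cyclic_on_chains_in_T_group)
      fix k and x :: "nat \<Rightarrow> ('s forest set \<times> nat) set"
      assume "k \<ge> 1" "\<And>i. i \<in> {1..k} \<Longrightarrow> x i \<in> X_set R" "\<And>i. i \<in> {1..<k} \<Longrightarrow> X_le R (x i) (x (i + 1))"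
      with g show "\<exists>\<rho>\<in>cyclic_perms k.
          \<forall>i\<in>{1..<k}. X_le R (X_act R g (x (\<rho> i))) (X_act R g (x (\<rho> (i + 1))))"
        by simp
    qed (use g in simp)
  qed
qed

end
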